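(* Let $\Sigma$ be an alphabet and $L \subseteq \Sigma^\omega$. The following are equivalent: (1) there are finitely many Parikh-recognizable languages $U_1,\dots,U_n \subseteq \Sigma^*$ and regular languages $V_1,\dots,V_n \subseteq \Sigma^*$ such that $L = \bigcup_{i=1}^n U_i V_i^\omega$; (2) $L$ is LPBA-recognizable; (3) $L$ is RPBA-recognizable.
   Context: An alphabet $\Sigma$ is a finite nonempty set; $\Sigma^*$ is the set of finite words, $\Sigma^\omega$ the set of infinite words $\alpha=\alpha_1\alpha_2\alpha_3\cdots$, and $\varepsilon$ the empty word. For $L\subseteq\Sigma^*$, $L^\omega=\{w_1w_2w_3\cdots \mid w_i\in L\setminus\{\varepsilon\}\}$. A linear set of dimension $d$ is a set $\{b_0+b_1z_1+\dots+b_\ell z_\ell \mid z_1,\dots,z_\ell\in\mathbb{N}\}$ with $b_0,\dots,b_\ell\in\mathbb{N}^d$ ($\mathbb{N}$ includes $0$); a semi-linear set is a finite union of linear sets. Semi-linear sets over $(\mathbb{N}\cup\{\infty\})^d$ are defined the same way with $b_j\in(\mathbb{N}\cup\{\infty\})^d$, using componentwise arithmetic with $z+\infty=\infty+z=\infty+\infty=\infty$, $z\cdot\infty=\infty\cdot z=\infty$ for $z>0$, and $0\cdot\infty=\infty\cdot 0=0$. A Parikh automaton (PA) of dimension $d$ is a tuple $\mathcal{A}=(Q,\Sigma,q_0,\Delta,F,C)$ with $Q$ a finite set of states, $q_0\in Q$, $F\subseteq Q$, a finite set $\Delta\subseteq Q\times\Sigma\times\mathbb{N}^d\times Q$ of labeled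 transitions, and $C\subseteq\mathbb{N}^d$ semi-linear. A run on a finite word $w=x_1\cdots x_n$ is a sequence $r_1\cdots r_n$ with $r_i=(p_{i-1},x_i,\mathbf{v}_i,p_i)\in\Delta$ and $p_0=q_0$; its extended Parikh image is $\rho(r)=\sum_{i\le n}\mathbf{v}_i$ (empty sum $=\mathbf{0}$); it is accepting if $p_n\in F$ and $\rho(r)\in C$. $L(\mathcal{A})$ is the set of finite words with an accepting run; a language is Parikh-recognizable if it is $L(\mathcal{A})$ for some PA. Regular languages are those recognized by nondeterministic finite automata. A run of $\mathcal{A}$ on an infinite word $\alpha$ is an infinite sequence $r_1r_2r_3\cdots$ with $r_i=(p_{i-1},\alpha_i,\mathbf{v}_i,p_i)\in\Delta$ and $p_0=q_0$. A reachability Parikh–Büchi automaton (RPBA) is a PA where such an infinite run is accepting if there is $i\ge1$ with $p_i\in F$ and $\rho(r_1\cdots r_i)\in C$, and there are infinitely many $j$ with $p_j\in F$. A limit Parikh–Büchi automaton (LPBA) is a tuple as for a PA except that $C\subseteq(\mathbb{N}\cup\{\infty\})^d$ is a semi-linear set over $(\mathbb{N}\cup\{\infty\})^d$; an infinite run is accepting if there are infinitely many $i$ with $p_i\in F$ and $\rho(r)\in C$, where the $j$-th component of $\rho(r)$ is $\infty$ if infinitely many $\mathbf{v}_i$ have a nonzero $j$-th component and otherwise is the (finite) sum of the $j$-th components of all $\mathbf{v}_i$. An $\omega$-language is X-recognizable if it is the set of infinite words on which some automaton of type X has an accepting run. *)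

theory Defs
  imports Main "HOL-Library.Extended_Nat" "HOL-Library.Infinite_Set"
begin

text \<open>Vectors of dimension d are lists of length d. Semi-linear sets are defined
 generically over a semiring with 1; the two instances used are nat (for N^d)
 and enat (for (N \<union> {\<infinity>})^d, where enat arithmetic gives 0*\<infinity> = 0).\<close>

definition vadd :: "'c::comm_semiring_1 list \<Rightarrow> 'c list \<Rightarrow> 'c list" where
  "vadd xs ys = map2 (+) xs ys"

definition vsmul :: "nat \<Rightarrow> 'c::comm_semiring_1 list \<Rightarrow> 'c list" where
  "vsmul z xs = map (\<lambda>x. of_nat z * x) xs"

definition lin_comb :: "'c::comm_semiring_1 list \<Rightarrow> 'c list list \<Rightarrow> nat list \<Rightarrow> 'c list" where
  "lin_comb b0 bs zs = foldr vadd (map2 vsmul zs bs) b0"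

definition linear_set :: "'c::comm_semiring_1 list \<Rightarrow> 'c list list \<Rightarrow> 'c list set" where
  "linear_set b0 bs = {lin_comb b0 bs zs | zs. length zs = length bs}"

definition semilinear :: "nat \<Rightarrow> 'c::comm_semiring_1 list set \<Rightarrow> bool" where
  "semilinear d C \<longleftrightarrow> (\<exists>gs :: ('c list \<times> 'c list list) list.
      (\<forall>(b0, bs) \<in> set gs. length b0 = d \<and> (\<forall>b \<in> set bs. length b = d)) \<and>
      C = (\<Union>(b0, bs) \<in> set gs. linear_set b0 bs))"

text \<open>States are natural numbers. A transition is (p, x, v, q).
 The parameter 'c is the type of entries of the constraint set:
 nat for PA / RPBA, enat for LPBA. Transition vectors are always in N^d.\<close>

type_synonym 'a ptrans = "nat \<times> 'a \<times> nat list \<times> nat"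

record ('a, 'c) pa =
  states :: "nat set"
  dim    :: nat
  init   :: nat
  trans  :: "'a ptrans set"
  final  :: "nat set"
  constr :: "'c list set"

definition src :: "'a ptrans \<Rightarrow> nat" where "src t = fst t"
definition lbl :: "'a ptrans \<Rightarrow> 'a" where "lbl t = fst (snd t)"
definition vec :: "'a ptrans \<Rightarrow> nat list" where "vec t = fst (snd (snd t))"
definition tgt :: "'a ptrans \<Rightarrow> nat" where "tgt t = snd (snd (snd t))"

definition is_pa :: "'a set \<Rightarrow> ('a, 'c::comm_semiring_1) pa \<Rightarrow> bool" where
  "is_pa \<Sigma> A \<longleftrightarrow> finite (states A) \<and> init A \<in> states A \<and> final A \<subseteq> states A \<and>
     finite (trans A) \<and>
     trans A \<subseteq> {(p, x, v, q). p \<in> states A \<and> x \<in> \<Sigma> \<and> length v = dim A \<and> q \<in> states A} \<and>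
     semilinear (dim A) (constr A)"

definition rho :: "nat \<Rightarrow> 'a ptrans list \<Rightarrow> nat list" where
  "rho d rs = foldr vadd (map vec rs) (replicate d 0)"

definition fin_run :: "('a, 'c) pa \<Rightarrow> 'a list \<Rightarrow> 'a ptrans list \<Rightarrow> bool" where
  "fin_run A w rs \<longleftrightarrow> length rs = length w \<and>
     (\<forall>i < length w. rs ! i \<in> trans A \<and> lbl (rs ! i) = w ! i) \<and>
     (w \<noteq> [] \<longrightarrow> src (rs ! 0) = init A) \<and>
     (\<forall>i. Suc i < length w \<longrightarrow> tgt (rs ! i) = src (rs ! Suc i))"

definition end_state :: "('a, 'c) pa \<Rightarrow> 'a ptrans list \<Rightarrow> nat" where
  "end_state A rs = (if rs = [] then init A else tgt (last rs))"

definition pa_lang :: "('a, nat) pa \<Rightarrow> 'a list set" where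
  "pa_lang A = {w. \<exists>rs. fin_run A w rs \<and> end_state A rs \<in> final A \<and> rho (dim A) rs \<in> constr A}"

definition parikh_recognizable :: "'a set \<Rightarrow> 'a list set \<Rightarrow> bool" where
  "parikh_recognizable \<Sigma> U \<longleftrightarrow> (\<exists>A :: ('a, nat) pa. is_pa \<Sigma> A \<and> pa_lang A = U)"

text \<open>Infinite words are functions nat \<Rightarrow> 'a (index 0 is the paper's first letter).
 An infinite run is r :: nat \<Rightarrow> transition; the paper's state p_i (i \<ge> 1) is tgt (r (i-1)).\<close>

definition inf_run :: "('a, 'c) pa \<Rightarrow> (nat \<Rightarrow> 'a) \<Rightarrow> (nat \<Rightarrow> 'a ptrans) \<Rightarrow> bool" where
  "inf_run A \<alpha> r \<longleftrightarrow> (\<forall>i. r i \<in> trans A \<and> lbl (r i) = \<alpha> i) \<and>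
     src (r 0) = init A \<and> (\<forall>i. tgt (r i) = src (r (Suc i)))"

definition rpba_accepting :: "('a, nat) pa \<Rightarrow> (nat \<Rightarrow> 'a ptrans) \<Rightarrow> bool" where
  "rpba_accepting A r \<longleftrightarrow>
     (\<exists>i. tgt (r i) \<in> final A \<and> rho (dim A) (map r [0..<Suc i]) \<in> constr A) \<and>
     (\<exists>\<^sub>\<infinity>j. tgt (r j) \<in> final A)"

definition rpba_lang :: "('a, nat) pa \<Rightarrow> (nat \<Rightarrow> 'a) set" where
  "rpba_lang A = {\<alpha>. \<exists>r. inf_run A \<alpha> r \<and> rpba_accepting A r}"

definition lim_rho :: "nat \<Rightarrow> (nat \<Rightarrow> 'a ptrans) \<Rightarrow> enat list" where
  "lim_rho d r = map (\<lambda>j. if infinite {k. vec (r k) ! j \<noteq> 0} then \<infinity>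
       else enat (\<Sum>k \<in> {k. vec (r k) ! j \<noteq> 0}. vec (r k) ! j)) [0..<d]"

definition lpba_accepting :: "('a, enat) pa \<Rightarrow> (nat \<Rightarrow> 'a ptrans) \<Rightarrow> bool" where
  "lpba_accepting A r \<longleftrightarrow> (\<exists>\<^sub>\<infinity>j. tgt (r j) \<in> final A) \<and> lim_rho (dim A) r \<in> constr A"

definition lpba_lang :: "('a, enat) pa \<Rightarrow> (nat \<Rightarrow> 'a) set" where
  "lpba_lang A = {\<alpha>. \<exists>r. inf_run A \<alpha> r \<and> lpba_accepting A r}"

definition rpba_recognizable :: "'a set \<Rightarrow> (nat \<Rightarrow> 'a) set \<Rightarrow> bool" where
  "rpba_recognizable \<Sigma> L \<longleftrightarrow> (\<exists>A :: ('a, nat) pa. is_pa \<Sigma> A \<and> rpba_lang A = L)"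

definition lpba_recognizable :: "'a set \<Rightarrow> (nat \<Rightarrow> 'a) set \<Rightarrow> bool" where
  "lpba_recognizable \<Sigma> L \<longleftrightarrow> (\<exists>A :: ('a, enat) pa. is_pa \<Sigma> A \<and> lpba_lang A = L)"

record 'a nfa =
  nstates :: "nat set"
  ninit   :: nat
  ndelta  :: "(nat \<times> 'a \<times> nat) set"
  nfinal  :: "nat set"

definition is_nfa :: "'a set \<Rightarrow> 'a nfa \<Rightarrow> bool" where
  "is_nfa \<Sigma> N \<longleftrightarrow> finite (nstates N) \<and> ninit N \<in> nstates N \<and> nfinal N \<subseteq> nstates N \<and>
     ndelta N \<subseteq> {(p, x, q). p \<in> nstates N \<and> x \<in> \<Sigma> \<and> q \<in> nstates N}"

definition nfa_lang :: "'a nfa \<Rightarrow> 'a list set" where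
  "nfa_lang N = {w. \<exists>ps. length ps = Suc (length w) \<and> ps ! 0 = ninit N \<and>
      (\<forall>i < length w. (ps ! i, w ! i, ps ! Suc i) \<in> ndelta N) \<and> last ps \<in> nfinal N}"

definition regular :: "'a set \<Rightarrow> 'a list set \<Rightarrow> bool" where
  "regular \<Sigma> V \<longleftrightarrow> (\<exists>N. is_nfa \<Sigma> N \<and> nfa_lang N = V)"

definition omega_pow :: "'a list set \<Rightarrow> (nat \<Rightarrow> 'a) set" where
  "omega_pow V = {\<alpha>. \<exists>f. strict_mono f \<and> f 0 = 0 \<and>
      (\<forall>i. map \<alpha> [f i..<f (Suc i)] \<in> V - {[]})}"

definition conc_omega :: "'a list set \<Rightarrow> (nat \<Rightarrow> 'a) set \<Rightarrow> (nat \<Rightarrow> 'a) set" where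
  "conc_omega U M = {\<alpha>. \<exists>u \<in> U. \<exists>\<beta> \<in> M.
      \<alpha> = (\<lambda>n. if n < length u then u ! n else \<beta> (n - length u))}"

end

(* Idea: prove (1) => (3) => (2) => (1).
   (1) => (3): simulate the Parikh automaton for U, then, without counting, the finite automaton for V
   with a single final state marking the ends of V-blocks; a marker coordinate makes the
   constraints of the finitely many pieces independent in the union.
   (3) => (2): guess the position at which the constraint is tested and stop counting there, so that
   the limit is the finite sum reached at that position.
   (2) => (1): split an accepting run by an infinitely often visited final state f and the set I of
   coordinates with limit infinity. From some visit of f on, no coordinate outside I changes, and
   the run decomposes into loops at f each of which increments every coordinate in I; such
   loops form a regular language, and the prefix has to satisfy the constraint outside I only. *)
theory Submission
  imports Defs "HOL-Library.Countable"
begin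

text \<open>An omega-power has no memory: every block is judged on its own by one regular language.
  This is the obstacle in (2) => (1): a block must begin and end in one fixed state and must itself
  witness progress on every coordinate of I. As there are only finitely many pairs (f, I), the union
  is finite. A finite prefix cannot be compared with infinite entries; once I is fixed, writing 0
  for infinity makes the relevant part of the constraint semi-linear over the naturals.

  In (1) => (3) the word from U may be empty, whereas a reachability test comes after at least one
  letter. The test is therefore made at a block boundary, where the sum is still that of the prefix.
  Accepting states of the Parikh automaton are not final in the result, since otherwise a run could
  visit final states infinitely often without completing a block.

  Runs are functions on absolute positions of the infinite word, so pieces are cut and glued without
  reindexing.\<close>

section \<open>Partial sums of vector sequences\<close>

definition psum :: "nat \<Rightarrow> (nat \<Rightarrow> nat list) \<Rightarrow> nat \<Rightarrow> nat list" where
  "psum d v n = map (\<lambda>j. \<Sum>k<n. v k ! j) [0..<d]"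

lemma length_psum [simp]: "length (psum d v n) = d"
  by (simp add: psum_def)

lemma nth_psum [simp]: "j < d \<Longrightarrow> psum d v n ! j = (\<Sum>k<n. v k ! j)"
  by (simp add: psum_def)

lemma psum_cong:
  "(\<And>k. k < n \<Longrightarrow> v k = v' k) \<Longrightarrow> psum d v n = psum d v' n"
  by (simp add: psum_def)

lemma psum_eq_of_zero_tail:
  assumes "m \<le> n" and "\<And>k. m \<le> k \<Longrightarrow> k < n \<Longrightarrow> v k = replicate d 0"
  shows "psum d v n = psum d v m"
proof (rule nth_equalityI)
  fix j assume "j < length (psum d v n)"
  then have "j < d" by simp
  have "(\<Sum>k<n. v k ! j) = (\<Sum>k<m. v k ! j)"
    using assms \<open>j < d\<close> by (intro sum.mono_neutral_right) auto
  then show "psum d v n ! j = psum d v m ! j"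
    using \<open>j < d\<close> by simp
qed simp

section \<open>Semilinear sets in coordinates\<close>

lemma foldr_vadd:
  assumes "\<forall>x \<in> set xs. length x = d" and "length b = d"
  shows "foldr vadd xs b = map (\<lambda>j. (\<Sum>x\<leftarrow>xs. x ! j) + b ! j) [0..<d]"
  using assms(1)
proof (induction xs)
  case Nil
  then show ?case using assms(2) by (simp add: list_eq_iff_nth_eq)
next
  case (Cons x xs)
  then have "foldr vadd xs b = map (\<lambda>j. (\<Sum>x\<leftarrow>xs. x ! j) + b ! j) [0..<d]" and "length x = d"
    by simp_all
  then show ?case
    by (intro nth_equalityI) (simp_all add: vadd_def[of x] add.assoc)
qed

lemma lin_comb_coord:
  assumes "length b0 = d" and "\<forall>b \<in> set bs. length b = d" and "length zs = length bs"
  shows "lin_comb b0 bs zs =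
    map (\<lambda>j. b0 ! j + (\<Sum>i<length bs. of_nat (zs ! i) * bs ! i ! j)) [0..<d]"
proof -
  have len: "\<forall>x \<in> set (map2 vsmul zs bs). length x = d"
    using assms(2) by (auto simp: vsmul_def dest!: set_zip_rightD)
  have "(\<Sum>x\<leftarrow>map2 vsmul zs bs. x ! j) = (\<Sum>i<length bs. of_nat (zs ! i) * bs ! i ! j)"
    if "j < d" for j
  proof -
    have "(\<Sum>x\<leftarrow>map2 vsmul zs bs. x ! j)
        = (\<Sum>i = 0..<length bs. map (\<lambda>x. x ! j) (map2 vsmul zs bs) ! i)"
      using assms(3) by (simp add: sum_list_sum_nth)
    also have "\<dots> = (\<Sum>i<length bs. of_nat (zs ! i) * bs ! i ! j)"
      using assms that by (intro sum.cong) (auto simp: vsmul_def)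
    finally show ?thesis .
  qed
  then show ?thesis
    unfolding lin_comb_def foldr_vadd[OF len assms(1)] by (simp add: add.commute)
qed

lemma semilinear_length:
  assumes "semilinear d C" and "c \<in> C"
  shows "length c = d"
proof -
  obtain gs where gs: "\<forall>(b0, bs) \<in> set gs. length b0 = d \<and> (\<forall>b \<in> set bs. length b = d)"
    "C = (\<Union>(b0, bs) \<in> set gs. linear_set b0 bs)"
    using assms(1) unfolding semilinear_def by auto
  obtain b0 bs where b: "(b0, bs) \<in> set gs" "c \<in> linear_set b0 bs"
    using gs(2) assms(2) by auto
  then obtain zs where "c = lin_comb b0 bs zs" "length zs = length bs"
    by (auto simp: linear_set_def)
  moreover have "length b0 = d" "\<forall>b \<in> set bs. length b = d"
    using gs(1) b(1) by auto
  ultimately show ?thesis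
    by (simp add: lin_comb_coord)
qed

lemma semilinear_linear_set:
  "length b0 = d \<Longrightarrow> \<forall>b \<in> set bs. length b = d \<Longrightarrow> semilinear d (linear_set b0 bs)"
  unfolding semilinear_def by (rule exI[of _ "[(b0, bs)]"]) auto

lemma semilinear_empty: "semilinear d {}"
  unfolding semilinear_def by (rule exI[of _ "[]"]) auto

lemma semilinear_Un:
  assumes "semilinear d C" and "semilinear d D"
  shows "semilinear d (C \<union> D)"
proof -
  obtain gs hs where
    "\<forall>(b0, bs) \<in> set gs. length b0 = d \<and> (\<forall>b \<in> set bs. length b = d)"
    "C = (\<Union>(b0, bs) \<in> set gs. linear_set b0 bs)"
    "\<forall>(b0, bs) \<in> set hs. length b0 = d \<and> (\<forall>b \<in> set bs. length b = d)"
    "D = (\<Union>(b0, bs) \<in> set hs. linear_set b0 bs)"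
    using assms unfolding semilinear_def by auto
  then show ?thesis
    unfolding semilinear_def by (intro exI[of _ "gs @ hs"]) auto
qed

lemma semilinear_UN:
  "finite I \<Longrightarrow> (\<And>i. i \<in> I \<Longrightarrow> semilinear d (C i)) \<Longrightarrow> semilinear d (\<Union>i\<in>I. C i)"
  by (induction I rule: finite_induct) (auto simp: semilinear_empty intro: semilinear_Un)

lemma semilinear_as_UN:
  assumes "semilinear d C"
  obtains G where "finite G" and "C = (\<Union>(b0, bs) \<in> G. linear_set b0 bs)"
    and "\<And>b0 bs. (b0, bs) \<in> G \<Longrightarrow> length b0 = d \<and> (\<forall>b \<in> set bs. length b = d)"
proof -
  obtain gs where gs: "\<forall>(b0, bs) \<in> set gs. length b0 = d \<and> (\<forall>b \<in> set bs. length b = d)"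
    "C = (\<Union>(b0, bs) \<in> set gs. linear_set b0 bs)"
    using assms unfolding semilinear_def by auto
  show thesis
    by (rule that[of "set gs"]) (use gs in auto)
qed

text \<open>\<open>h\<close> is affine with linear part \<open>h1\<close>: the base occurs once and
  may pick up a constant, whereas periods are repeated and must be transformed linearly.\<close>

lemma semilinear_image:
  assumes C: "semilinear d C"
    and hom: "\<And>b0 bs zs. length b0 = d \<Longrightarrow> \<forall>b \<in> set bs. length b = d \<Longrightarrow> length zs = length bs
      \<Longrightarrow> h (lin_comb b0 bs zs) = lin_comb (h b0) (map h1 bs) zs"
    and len: "\<And>b. length b = d \<Longrightarrow> length (h b) = d'" "\<And>b. length b = d \<Longrightarrow> length (h1 b) = d'"
  shows "semilinear d' (h ` C)"
proof -
  obtain G where G: "finite G" "C = (\<Union>(b0, bs) \<in> G. linear_set b0 bs)"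
    "\<And>b0 bs. (b0, bs) \<in> G \<Longrightarrow> length b0 = d \<and> (\<forall>b \<in> set bs. length b = d)"
    using semilinear_as_UN[OF C] by metis
  have "h ` linear_set b0 bs = linear_set (h b0) (map h1 bs)" if "(b0, bs) \<in> G" for b0 bs
    using G(3)[OF that] hom unfolding linear_set_def by (auto simp: image_iff) metis+
  then have "h ` C = (\<Union>(b0, bs) \<in> G. linear_set (h b0) (map h1 bs))"
    unfolding G(2) image_UN by (intro SUP_cong) auto
  moreover have "semilinear d' (linear_set (h b0) (map h1 bs))" if "(b0, bs) \<in> G" for b0 bs
    using G(3)[OF that] len by (intro semilinear_linear_set) auto
  ultimately show ?thesis
    using semilinear_UN[OF G(1), of d' "\<lambda>(b0, bs). linear_set (h b0) (map h1 bs)"] by auto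
qed

lemma enat_sum: "enat (\<Sum>i\<in>I. f i) = (\<Sum>i\<in>I. enat (f i))"
  by (induction I rule: infinite_finite_induct)
    (simp_all add: zero_enat_def flip: plus_enat_simps(1))

lemma semilinear_map_enat:
  assumes "semilinear d C"
  shows "semilinear d (map enat ` C)"
proof (rule semilinear_image[OF assms, where ?h1.0 = "map enat"])
  fix b0 :: "nat list" and bs :: "nat list list" and zs :: "nat list"
  assume *: "length b0 = d" "\<forall>b \<in> set bs. length b = d" "length zs = length bs"
  have "enat (b0 ! j + (\<Sum>i<length bs. of_nat (zs ! i) * bs ! i ! j))
      = map enat b0 ! j + (\<Sum>i<length bs. of_nat (zs ! i) * map (map enat) bs ! i ! j)"
    if "j < d" for j
  proof -
    have "enat (of_nat (zs ! i) * bs ! i ! j) = of_nat (zs ! i) * map (map enat) bs ! i ! j"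
      if "i < length bs" for i
      using * \<open>j < d\<close> that by (simp add: of_nat_eq_enat)
    then show ?thesis
      using * \<open>j < d\<close> unfolding plus_enat_simps(1)[symmetric] enat_sum by simp
  qed
  then show "map enat (lin_comb b0 bs zs) = lin_comb (map enat b0) (map (map enat) bs) zs"
    using * by (subst (1 2) lin_comb_coord[where d = d]) auto
qed auto

text \<open>The union automaton stores the index of the chosen component in coordinate 0.\<close>

definition pad :: "nat \<Rightarrow> nat \<Rightarrow> nat list \<Rightarrow> nat list" where
  "pad D i v = i # v @ replicate (D - length v) 0"

lemma length_pad [simp]: "length v \<le> D \<Longrightarrow> length (pad D i v) = Suc D"
  by (simp add: pad_def)

lemma pad_inject: "length v = length w \<Longrightarrow> pad D i v = pad D j w \<longleftrightarrow> i = j \<and> v = w"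
  by (simp add: pad_def)

lemma nth_pad:
  "j \<le> D \<Longrightarrow> length v \<le> D \<Longrightarrow> pad D i v ! j =
    (if j = 0 then i else if j \<le> length v then v ! (j - 1) else 0)"
  by (cases j) (auto simp: pad_def nth_append)

lemma semilinear_pad:
  assumes "semilinear d C" and "d \<le> D"
  shows "semilinear (Suc D) (pad D i ` C)"
\<comment> \<open>The tag is a constant, so it sits in the base only; periods get tag 0 and leave it
  unchanged under repetition.\<close>
proof (rule semilinear_image[OF assms(1), where ?h1.0 = "pad D 0"])
  fix b0 :: "nat list" and bs :: "nat list list" and zs :: "nat list"
  assume *: "length b0 = d" "\<forall>b \<in> set bs. length b = d" "length zs = length bs"
  then have l: "length (lin_comb b0 bs zs) = d" by (simp add: lin_comb_coord)
  have bl: "length (bs ! i) = d" if "i < length bs" for i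
    using * that by simp
  have len: "length (pad D i b0) = Suc D" "\<forall>b \<in> set (map (pad D 0) bs). length b = Suc D"
    using * assms(2) by auto
  show "pad D i (lin_comb b0 bs zs) = lin_comb (pad D i b0) (map (pad D 0) bs) zs"
  proof (rule nth_equalityI)
    fix j assume "j < length (pad D i (lin_comb b0 bs zs))"
    then have j: "j \<le> D" using l assms(2) by simp
    have "lin_comb (pad D i b0) (map (pad D 0) bs) zs ! j
        = pad D i b0 ! j + (\<Sum>i<length bs. zs ! i * pad D 0 (bs ! i) ! j)"
      using j * by (simp add: lin_comb_coord[OF len] del: upt_Suc)
    also have "\<dots> = pad D i (lin_comb b0 bs zs) ! j"
      using j * l assms(2) bl by (auto simp: nth_pad lin_comb_coord[OF *])
    finally show "pad D i (lin_comb b0 bs zs) ! j = lin_comb (pad D i b0) (map (pad D 0) bs) zs ! j"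
      by simp
  qed (use l assms(2) * in \<open>simp add: lin_comb_coord[OF len]\<close>)
qed (use assms in auto)

text \<open>Only the first vector contributes the tag, so every nonempty partial sum carries it
  exactly once; hence the length \<open>Suc m\<close>.\<close>

lemma psum_pad:
  assumes "\<And>k. k \<le> m \<Longrightarrow> length (v k) = d" and "d \<le> D"
  shows "psum (Suc D) (\<lambda>k. pad D (if k = 0 then i else 0) (v k)) (Suc m) = pad D i (psum d v (Suc m))"
proof (rule nth_equalityI)
  fix j assume "j < length (psum (Suc D) (\<lambda>k. pad D (if k = 0 then i else 0) (v k)) (Suc m))"
  then have "j \<le> D" by simp
  then show "psum (Suc D) (\<lambda>k. pad D (if k = 0 then i else 0) (v k)) (Suc m) ! j
      = pad D i (psum d v (Suc m)) ! j"
    using assms by (auto simp: nth_pad sum.lessThan_Suc_shift simp del: sum.lessThan_Suc)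
qed (use assms in simp)

text \<open>Replacing infinite entries by 0 preserves semilinearity once the set of infinite positions
  is fixed: which generators occur with a positive coefficient determines the infinite positions.\<close>

definition inf_pos :: "enat list \<Rightarrow> nat set" where
  "inf_pos c = {j. j < length c \<and> c ! j = \<infinity>}"

definition fin_part :: "enat list \<Rightarrow> nat list" where
  "fin_part c = map (\<lambda>x. case x of enat n \<Rightarrow> n | \<infinity> \<Rightarrow> 0) c"

text \<open>Allows a limit vector to be identified by checking its infinite positions and its finite
  part separately.\<close>

lemma fin_part_inject:
  assumes "length c = length c'" and "inf_pos c = inf_pos c'" and "fin_part c = fin_part c'"
  shows "c = c'"
proof (rule nth_equalityI)
  fix j assume j: "j < length c"
  have "c ! j = \<infinity> \<longleftrightarrow> c' ! j = \<infinity>"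
    using assms(1,2) j by (auto simp: inf_pos_def)
  moreover have "fin_part c ! j = fin_part c' ! j" using assms(3) by simp
  ultimately show "c ! j = c' ! j"
    using j assms(1) by (auto simp: fin_part_def split: enat.splits)
qed (use assms in simp)

lemma sum_eq_infinity_iff:
  "finite A \<Longrightarrow> sum f A = (\<infinity>::enat) \<longleftrightarrow> (\<exists>i\<in>A. f i = \<infinity>)"
  by (induction A rule: finite_induct) (auto simp: plus_eq_infty_iff_enat)

text \<open>\<open>S\<close> is the set of periods with positive coefficient. Periods outside
  \<open>S\<close> contribute nothing, as 0 times infinity is 0, and an infinite entry stays
  infinite under any positive coefficient; so the infinite positions depend on \<open>S\<close>
  alone. Writing the coefficients on \<open>S\<close> as \<open>Suc (zs' ! i)\<close> moves one
  mandatory copy of each such period into the new base \<open>f0\<close> and leaves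
  \<open>zs'\<close> unconstrained.\<close>

lemma fin_part_lin_comb:
  fixes b0 :: "enat list" and bs :: "enat list list" and S I :: "nat set" and d :: nat
  defines "f0 \<equiv> map (\<lambda>j. if j \<in> I then 0 else
      fin_part b0 ! j + (\<Sum>i | i < length bs \<and> i \<in> S. fin_part (bs ! i) ! j)) [0..<d]"
    and "fs \<equiv> map (\<lambda>i. map (\<lambda>j. if j \<in> I \<or> i \<notin> S then 0 else fin_part (bs ! i) ! j) [0..<d])
      [0..<length bs]"
  assumes len: "length b0 = d" "\<forall>b \<in> set bs. length b = d" "length zs = length bs"
      "length zs' = length bs"
    and zs: "\<forall>i < length bs. zs ! i = (if i \<in> S then Suc (zs' ! i) else 0)"
  shows "inf_pos (lin_comb b0 bs zs) = inf_pos b0 \<union> (\<Union>i \<in> S \<inter> {..<length bs}. inf_pos (bs ! i))"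
    and "inf_pos (lin_comb b0 bs zs) = I \<Longrightarrow>
      fin_part (lin_comb b0 bs zs) = lin_comb f0 fs zs'"
proof -
  let ?c = "lin_comb b0 bs zs"
  have lc: "length ?c = d" using len by (simp add: lin_comb_coord)
  have bl: "length (bs ! i) = d" if "i < length bs" for i
    using len that by simp
  have c: "?c ! j = b0 ! j + (\<Sum>i<length bs. of_nat (zs ! i) * bs ! i ! j)" if "j < d" for j
    using len that by (simp add: lin_comb_coord)
  have term_inf: "of_nat (zs ! i) * bs ! i ! j = \<infinity> \<longleftrightarrow> i \<in> S \<and> bs ! i ! j = \<infinity>"
    if "i < length bs" for i j
    using zs that by (simp add: imult_is_infinity of_nat_eq_enat zero_enat_def)
  have "?c ! j = \<infinity> \<longleftrightarrow> b0 ! j = \<infinity> \<or> (\<exists>i<length bs. i \<in> S \<and> bs ! i ! j = \<infinity>)" if "j < d" for j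
    unfolding c[OF that] plus_eq_infty_iff_enat sum_eq_infinity_iff[OF finite_lessThan]
    using term_inf by auto
  then show inf: "inf_pos ?c = inf_pos b0 \<union> (\<Union>i \<in> S \<inter> {..<length bs}. inf_pos (bs ! i))"
    using lc bl len(1) by (auto simp: inf_pos_def)
  assume I: "inf_pos ?c = I"
  have lf: "length f0 = d" "\<forall>b \<in> set fs. length b = d" "length zs' = length fs"
    using len by (auto simp: f0_def fs_def)
  show "fin_part ?c = lin_comb f0 fs zs'"
  proof (rule nth_equalityI)
    fix j assume "j < length (fin_part ?c)"
    then have j: "j < d" using lc by (simp add: fin_part_def)
    have R: "lin_comb f0 fs zs' ! j = f0 ! j + (\<Sum>i<length bs. zs' ! i * fs ! i ! j)"
      using j by (simp add: lin_comb_coord[OF lf]) (simp add: fs_def)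
    show "fin_part ?c ! j = lin_comb f0 fs zs' ! j"
    proof (cases "j \<in> I")
      case True
      then have "?c ! j = \<infinity>" using I by (auto simp: inf_pos_def)
      then have "fin_part ?c ! j = 0" using j lc by (simp add: fin_part_def)
      then show ?thesis using True j unfolding R by (simp add: f0_def fs_def)
    next
      case False
      let ?x = "\<lambda>i. if i \<in> S then fin_part (bs ! i) ! j else 0"
      have "j \<notin> inf_pos b0" using False inf I by auto
      then have b0: "b0 ! j = enat (fin_part b0 ! j)"
        using j len(1) by (auto simp: inf_pos_def fin_part_def)
      have bs: "of_nat (zs ! i) * bs ! i ! j = enat (zs ! i * ?x i)" if "i < length bs" for i
      proof (cases "i \<in> S")
        case True
        then have "j \<notin> inf_pos (bs ! i)" using False inf I that by auto
        then obtain n where "bs ! i ! j = enat n"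
          using j bl[OF \<open>i < length bs\<close>] by (auto simp: inf_pos_def)
        then show ?thesis
          using True j bl[OF that] by (simp add: fin_part_def of_nat_eq_enat)
      qed (use zs that in \<open>simp flip: zero_enat_def\<close>)
      \<comment> \<open>One copy of a period from \<open>S\<close> goes into \<open>f0\<close>, the
        other \<open>zs' ! i\<close> copies stay with \<open>fs\<close>.\<close>
      have split: "zs ! i * ?x i = ?x i + zs' ! i * fs ! i ! j" if "i < length bs" for i
        using zs that that j False by (simp add: fs_def)
      have "?c ! j = enat (fin_part b0 ! j + (\<Sum>i<length bs. zs ! i * ?x i))"
        unfolding c[OF j] plus_enat_simps(1)[symmetric] enat_sum b0 using bs by simp
      then have "fin_part ?c ! j = fin_part b0 ! j + (\<Sum>i<length bs. zs ! i * ?x i)"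
        using j lc by (simp add: fin_part_def)
      also have "(\<Sum>i<length bs. zs ! i * ?x i)
          = (\<Sum>i<length bs. ?x i) + (\<Sum>i<length bs. zs' ! i * fs ! i ! j)"
        unfolding sum.distrib[symmetric] using split by (intro sum.cong) auto
      also have "(\<Sum>i<length bs. ?x i)
          = (\<Sum>i | i < length bs \<and> i \<in> S. fin_part (bs ! i) ! j)"
        using sum.inter_filter[of "{..<length bs}" "\<lambda>i. fin_part (bs ! i) ! j" "\<lambda>i. i \<in> S"]
        by simp
      finally show ?thesis
        unfolding R using j False by (simp add: f0_def)
    qed
  qed (use lc in \<open>simp add: lin_comb_coord[OF lf] fin_part_def\<close>)
qed

text \<open>Coefficient vectors are sorted by their support \<open>S\<close>. The supports in
  \<open>\<S>\<close> are those that produce exactly the infinite positions \<open>I\<close>; there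
  are finitely many, and each yields one linear set.\<close>

lemma semilinear_fin_part_linear_set:
  assumes len: "length b0 = d" "\<forall>b \<in> set bs. length b = d"
  shows "semilinear d (fin_part ` {c \<in> linear_set b0 bs. inf_pos c = I})"
proof -
  define f0 where "f0 S = map (\<lambda>j. if j \<in> I then 0 else
      fin_part b0 ! j + (\<Sum>i | i < length bs \<and> i \<in> S. fin_part (bs ! i) ! j)) [0..<d]" for S
  define fs where "fs S = map (\<lambda>i. map (\<lambda>j. if j \<in> I \<or> i \<notin> S then 0 else
      fin_part (bs ! i) ! j) [0..<d]) [0..<length bs]" for S
  define \<S> where "\<S> = {S. S \<subseteq> {..<length bs} \<and>
      inf_pos b0 \<union> (\<Union>i \<in> S \<inter> {..<length bs}. inf_pos (bs ! i)) = I}"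
  note core = fin_part_lin_comb(1)[OF len]
    fin_part_lin_comb(2)[where I = I, OF len, folded f0_def fs_def]
  have lfs [simp]: "length (fs S) = length bs" for S by (simp add: fs_def)
  have "fin_part ` {c \<in> linear_set b0 bs. inf_pos c = I} = (\<Union>S\<in>\<S>. linear_set (f0 S) (fs S))"
  proof (intro equalityI subsetI)
    fix y assume "y \<in> fin_part ` {c \<in> linear_set b0 bs. inf_pos c = I}"
    then obtain zs where zs: "length zs = length bs" "inf_pos (lin_comb b0 bs zs) = I"
      "y = fin_part (lin_comb b0 bs zs)"
      by (auto simp: linear_set_def)
    define S where "S = {i. i < length bs \<and> zs ! i \<noteq> 0}"
    \<comment> \<open>Decrementing truncates at 0 outside \<open>S\<close>, where the period in
      \<open>fs S\<close> is the zero vector.\<close>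
    let ?zs' = "map (\<lambda>z. z - 1) zs"
    have l: "length ?zs' = length bs"
      and s: "\<forall>i < length bs. zs ! i = (if i \<in> S then Suc (?zs' ! i) else 0)"
      using zs(1) by (auto simp: S_def)
    note c = core(1)[OF zs(1) l s] core(2)[OF zs(1) l s]
    have "S \<in> \<S>" using c(1) zs(2) by (auto simp: \<S>_def S_def)
    moreover have "y \<in> linear_set (f0 S) (fs S)"
      unfolding linear_set_def zs(3) c(2)[OF zs(2)] using l by auto
    ultimately show "y \<in> (\<Union>S\<in>\<S>. linear_set (f0 S) (fs S))" by blast
  next
    fix y assume "y \<in> (\<Union>S\<in>\<S>. linear_set (f0 S) (fs S))"
    then obtain S zs' where S: "S \<in> \<S>" and l: "length zs' = length bs"
      and y: "y = lin_comb (f0 S) (fs S) zs'"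
      by (auto simp: linear_set_def)
    define zs where "zs = map (\<lambda>i. if i \<in> S then Suc (zs' ! i) else 0) [0..<length bs]"
    have zs: "length zs = length bs"
      "\<forall>i < length bs. zs ! i = (if i \<in> S then Suc (zs' ! i) else 0)"
      by (simp_all add: zs_def)
    note c = core(1)[OF zs(1) l zs(2)] core(2)[OF zs(1) l zs(2)]
    have inf: "inf_pos (lin_comb b0 bs zs) = I"
      using c(1) S by (simp add: \<S>_def)
    then show "y \<in> fin_part ` {c \<in> linear_set b0 bs. inf_pos c = I}"
      using c(2)[OF inf] y zs(1) by (auto simp: linear_set_def image_iff)
  qed
  moreover have "finite \<S>"
    by (rule finite_subset[of _ "Pow {..<length bs}"]) (auto simp: \<S>_def)
  moreover have "semilinear d (linear_set (f0 S) (fs S))" for S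
    by (rule semilinear_linear_set) (auto simp: f0_def fs_def)
  ultimately show ?thesis by (simp add: semilinear_UN)
qed

lemma semilinear_fin_part:
  assumes "semilinear d C"
  shows "semilinear d (fin_part ` {c \<in> C. inf_pos c = I})"
proof -
  obtain G where G: "finite G" "C = (\<Union>(b0, bs) \<in> G. linear_set b0 bs)"
    "\<And>b0 bs. (b0, bs) \<in> G \<Longrightarrow> length b0 = d \<and> (\<forall>b \<in> set bs. length b = d)"
    using semilinear_as_UN[OF assms] by metis
  have "fin_part ` {c \<in> C. inf_pos c = I}
      = (\<Union>g \<in> G. fin_part ` {c \<in> linear_set (fst g) (snd g). inf_pos c = I})"
    unfolding G(2) by (auto simp: case_prod_unfold)
  moreover have "semilinear d (fin_part ` {c \<in> linear_set (fst g) (snd g). inf_pos c = I})"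
    if "g \<in> G" for g
    using G(3)[of "fst g" "snd g"] that by (intro semilinear_fin_part_linear_set) auto
  ultimately show ?thesis using G(1) by (simp add: semilinear_UN)
qed

section \<open>Runs as sequences of states and vectors\<close>

lemma rho_eq_psum:
  assumes "\<And>k. k < n \<Longrightarrow> length (vec (r k)) = d"
  shows "rho d (map r [0..<n]) = psum d (\<lambda>k. vec (r k)) n"
proof -
  have "rho d (map r [0..<n]) = map (\<lambda>j. (\<Sum>x\<leftarrow>map vec (map r [0..<n]). x ! j) + replicate d 0 ! j) [0..<d]"
    unfolding rho_def by (rule foldr_vadd) (use assms in auto)
  then show ?thesis
    by (simp add: psum_def o_def interv_sum_list_conv_sum_set_nat atLeast0LessThan)
qed

text \<open>Splitting a run into states and vectors lets a construction change one without touching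
  the other. \<open>s k\<close> is the state before letter \<open>k\<close>.\<close>

definition inf_path :: "('a, 'c) pa \<Rightarrow> (nat \<Rightarrow> 'a) \<Rightarrow> (nat \<Rightarrow> nat) \<Rightarrow> (nat \<Rightarrow> nat list) \<Rightarrow> bool" where
  "inf_path A \<alpha> s v \<longleftrightarrow> s 0 = init A \<and> (\<forall>k. (s k, \<alpha> k, v k, s (Suc k)) \<in> trans A)"

lemma inf_pathD: "inf_path A \<alpha> s v \<Longrightarrow> (s k, \<alpha> k, v k, s (Suc k)) \<in> trans A"
  by (simp add: inf_path_def)

lemma is_pa_transD:
  "is_pa \<Sigma> A \<Longrightarrow> (p, x, v, q) \<in> trans A \<Longrightarrow>
    p \<in> states A \<and> x \<in> \<Sigma> \<and> length v = dim A \<and> q \<in> states A"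
  by (auto simp: is_pa_def)

lemma inf_run_path:
  assumes "inf_run A \<alpha> r"
  shows "inf_path A \<alpha> (\<lambda>k. src (r k)) (\<lambda>k. vec (r k))"
  unfolding inf_path_def
proof (intro conjI allI)
  fix k
  have "r k = (src (r k), lbl (r k), vec (r k), tgt (r k))"
    by (simp add: src_def lbl_def vec_def tgt_def)
  then show "(src (r k), \<alpha> k, vec (r k), src (r (Suc k))) \<in> trans A"
    using assms unfolding inf_run_def by metis
qed (use assms in \<open>simp add: inf_run_def\<close>)

lemma path_inf_run:
  "inf_path A \<alpha> s v \<Longrightarrow> inf_run A \<alpha> (\<lambda>k. (s k, \<alpha> k, v k, s (Suc k)))"
  by (simp add: inf_run_def inf_path_def src_def lbl_def tgt_def)

lemma INFM_Suc_iff: "(\<exists>\<^sub>\<infinity>k. P (Suc k)) \<longleftrightarrow> (\<exists>\<^sub>\<infinity>k. P k)"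
  unfolding frequently_def cofinite_eq_sequentially
  by (simp add: eventually_sequentially_Suc[of "\<lambda>k. \<not> P k"])

text \<open>The test is at \<open>Suc i\<close> because acceptance looks at states after at least
  one transition; for the infinitely many visits this shift is immaterial.\<close>

lemma rpba_lang_iff:
  assumes "is_pa \<Sigma> A"
  shows "\<alpha> \<in> rpba_lang A \<longleftrightarrow> (\<exists>s v. inf_path A \<alpha> s v \<and>
    (\<exists>i. s (Suc i) \<in> final A \<and> psum (dim A) v (Suc i) \<in> constr A) \<and> (\<exists>\<^sub>\<infinity>k. s k \<in> final A))"
    (is "_ \<longleftrightarrow> ?R")
proof
  assume "\<alpha> \<in> rpba_lang A"
  then obtain r where r: "inf_run A \<alpha> r" "rpba_accepting A r"
    by (auto simp: rpba_lang_def)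
  note p = inf_run_path[OF r(1)]
  have "length (vec (r k)) = dim A" for k
    using is_pa_transD[OF assms inf_pathD[OF p]] by simp
  then have "rho (dim A) (map r [0..<n]) = psum (dim A) (\<lambda>k. vec (r k)) n" for n
    by (simp add: rho_eq_psum)
  moreover have "tgt (r k) = src (r (Suc k))" for k
    using r(1) by (simp add: inf_run_def)
  ultimately show ?R
    using p r(2) INFM_Suc_iff[of "\<lambda>k. src (r k) \<in> final A"] unfolding rpba_accepting_def
    by (intro exI[of _ "\<lambda>k. src (r k)"] exI[of _ "\<lambda>k. vec (r k)"]) (simp del: upt_Suc)
next
  assume ?R
  then obtain s v where p: "inf_path A \<alpha> s v"
    and i: "\<exists>i. s (Suc i) \<in> final A \<and> psum (dim A) v (Suc i) \<in> constr A"
    and j: "\<exists>\<^sub>\<infinity>k. s k \<in> final A" by blast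
  let ?r = "\<lambda>k. (s k, \<alpha> k, v k, s (Suc k))"
  have "length (v k) = dim A" for k
    using is_pa_transD[OF assms inf_pathD[OF p]] by simp
  then have "rho (dim A) (map ?r [0..<n]) = psum (dim A) v n" for n
    by (subst rho_eq_psum) (auto simp: vec_def)
  then have "rpba_accepting A ?r"
    using i j INFM_Suc_iff[of "\<lambda>k. s k \<in> final A"] unfolding rpba_accepting_def
    by (simp add: tgt_def del: upt_Suc)
  then show "\<alpha> \<in> rpba_lang A"
    using path_inf_run[OF p] by (auto simp: rpba_lang_def)
qed

definition lim_sum :: "nat \<Rightarrow> (nat \<Rightarrow> nat list) \<Rightarrow> enat list" where
  "lim_sum d v = map (\<lambda>j. if infinite {k. v k ! j \<noteq> 0} then \<infinity>
     else enat (\<Sum>k \<in> {k. v k ! j \<noteq> 0}. v k ! j)) [0..<d]"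

lemma lpba_lang_iff:
  "\<alpha> \<in> lpba_lang A \<longleftrightarrow> (\<exists>s v. inf_path A \<alpha> s v \<and>
    (\<exists>\<^sub>\<infinity>k. s k \<in> final A) \<and> lim_sum (dim A) v \<in> constr A)" (is "_ \<longleftrightarrow> ?R")
proof
  assume "\<alpha> \<in> lpba_lang A"
  then obtain r where r: "inf_run A \<alpha> r" "lpba_accepting A r"
    by (auto simp: lpba_lang_def)
  moreover have "tgt (r k) = src (r (Suc k))" for k
    using r(1) by (simp add: inf_run_def)
  ultimately show ?R
    using inf_run_path[OF r(1)] INFM_Suc_iff[of "\<lambda>k. src (r k) \<in> final A"]
    unfolding lpba_accepting_def lim_rho_def lim_sum_def
    by (intro exI[of _ "\<lambda>k. src (r k)"] exI[of _ "\<lambda>k. vec (r k)"]) simp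
next
  assume ?R
  then obtain s v where p: "inf_path A \<alpha> s v"
    and i: "lim_sum (dim A) v \<in> constr A" and j: "\<exists>\<^sub>\<infinity>k. s k \<in> final A" by blast
  then have "lpba_accepting A (\<lambda>k. (s k, \<alpha> k, v k, s (Suc k)))"
    using INFM_Suc_iff[of "\<lambda>k. s k \<in> final A"]
    unfolding lpba_accepting_def lim_rho_def lim_sum_def by (simp add: tgt_def vec_def cong: if_cong)
  then show "\<alpha> \<in> lpba_lang A"
    using path_inf_run[OF p] by (auto simp: lpba_lang_def)
qed

text \<open>Total functions with arbitrary values past the prefix can be restrictions of an infinite
  run or be extended to one. For \<open>m = 0\<close> the conditions concern only the initial state
  and the zero vector.\<close>

lemma prefix_in_pa_lang_iff:
  assumes "is_pa \<Sigma> A"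
  shows "map \<alpha> [0..<m] \<in> pa_lang A \<longleftrightarrow> (\<exists>s v. s 0 = init A \<and>
    (\<forall>k<m. (s k, \<alpha> k, v k, s (Suc k)) \<in> trans A) \<and> s m \<in> final A \<and>
    psum (dim A) v m \<in> constr A)" (is "_ \<longleftrightarrow> ?R")
proof
  assume "map \<alpha> [0..<m] \<in> pa_lang A"
  then obtain rs where rs: "fin_run A (map \<alpha> [0..<m]) rs" "end_state A rs \<in> final A"
    "rho (dim A) rs \<in> constr A"
    by (auto simp: pa_lang_def)
  have len: "length rs = m"
    using rs(1) by (simp add: fin_run_def)
  have step: "rs ! k \<in> trans A" "lbl (rs ! k) = \<alpha> k" if "k < m" for k
    using rs(1) that by (auto simp: fin_run_def)
  define s where "s k = (if k = 0 then init A else tgt (rs ! (k - 1)))" for k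
  have src: "src (rs ! k) = s k" if "k < m" for k
    using rs(1) that by (cases k) (auto simp: s_def fin_run_def)
  have tr: "(s k, \<alpha> k, vec (rs ! k), s (Suc k)) \<in> trans A" if "k < m" for k
  proof -
    have "rs ! k = (src (rs ! k), lbl (rs ! k), vec (rs ! k), tgt (rs ! k))"
      by (simp add: src_def lbl_def vec_def tgt_def)
    then show ?thesis
      using step[OF that] src[OF that] by (simp add: s_def)
  qed
  have "rho (dim A) (map (\<lambda>k. rs ! k) [0..<m]) = psum (dim A) (\<lambda>k. vec (rs ! k)) m"
    by (rule rho_eq_psum) (use is_pa_transD[OF assms tr] in simp)
  then have "psum (dim A) (\<lambda>k. vec (rs ! k)) m \<in> constr A"
    using rs(3) map_nth[of rs] len by metis
  moreover have "s m = end_state A rs"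
    using len by (auto simp: s_def end_state_def last_conv_nth)
  ultimately show ?R
    using tr rs(2) by (intro exI[of _ s] exI[of _ "\<lambda>k. vec (rs ! k)"]) (auto simp: s_def)
next
  assume ?R
  then obtain s v where sv: "s 0 = init A" "s m \<in> final A" "psum (dim A) v m \<in> constr A"
    and tr: "\<And>k. k < m \<Longrightarrow> (s k, \<alpha> k, v k, s (Suc k)) \<in> trans A" by blast
  let ?rs = "map (\<lambda>k. (s k, \<alpha> k, v k, s (Suc k))) [0..<m]"
  have "fin_run A (map \<alpha> [0..<m]) ?rs"
    using sv(1) tr by (auto simp: fin_run_def src_def lbl_def tgt_def)
  moreover have "end_state A ?rs = s m"
    using sv(1) by (cases m) (auto simp: end_state_def tgt_def)
  moreover have "rho (dim A) ?rs = psum (dim A) v m"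
    by (subst rho_eq_psum) (use is_pa_transD[OF assms tr] in \<open>auto simp: vec_def\<close>)
  ultimately show "map \<alpha> [0..<m] \<in> pa_lang A"
    using sv unfolding pa_lang_def by auto
qed

text \<open>States sit at the absolute positions \<open>a\<close> to \<open>b\<close>, so runs on
  neighbouring blocks refer to the same cut position.\<close>

lemma factor_in_nfa_lang_iff:
  assumes "a \<le> b"
  shows "map \<alpha> [a..<b] \<in> nfa_lang N \<longleftrightarrow> (\<exists>t. t a = ninit N \<and>
    (\<forall>k. a \<le> k \<and> k < b \<longrightarrow> (t k, \<alpha> k, t (Suc k)) \<in> ndelta N) \<and> t b \<in> nfinal N)"
    (is "_ \<longleftrightarrow> ?R")
proof
  assume "map \<alpha> [a..<b] \<in> nfa_lang N"
  then obtain ps where ps: "length ps = Suc (b - a)" "ps ! 0 = ninit N"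
    "\<And>i. i < b - a \<Longrightarrow> (ps ! i, \<alpha> (a + i), ps ! Suc i) \<in> ndelta N" "last ps \<in> nfinal N"
    by (auto simp: nfa_lang_def)
  have "ps \<noteq> []" using ps(1) by auto
  then have "last ps = ps ! (b - a)" using ps(1) by (simp add: last_conv_nth)
  moreover have "(ps ! (k - a), \<alpha> k, ps ! (Suc k - a)) \<in> ndelta N" if "a \<le> k" "k < b" for k
    using ps(3)[of "k - a"] that by (simp add: Suc_diff_le)
  ultimately show ?R
    using ps by (intro exI[of _ "\<lambda>k. ps ! (k - a)"]) auto
next
  assume ?R
  then obtain t where t: "t a = ninit N" "t b \<in> nfinal N"
    "\<And>k. a \<le> k \<Longrightarrow> k < b \<Longrightarrow> (t k, \<alpha> k, t (Suc k)) \<in> ndelta N" by blast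
  let ?ps = "map t [a..<Suc b]"
  have "last ?ps = t b" "?ps ! 0 = t a"
    using assms by (simp_all add: nth_append)
  moreover have "(?ps ! i, map \<alpha> [a..<b] ! i, ?ps ! Suc i) \<in> ndelta N" if "i < b - a" for i
    using t(3)[of "a + i"] that by (simp add: nth_append del: upt_Suc)
  ultimately show "map \<alpha> [a..<b] \<in> nfa_lang N"
    using t assms unfolding nfa_lang_def by (auto simp: Suc_diff_le intro!: exI[of _ ?ps] simp del: upt_Suc)
qed

lemma pa_lang_subset_lists: "is_pa \<Sigma> A \<Longrightarrow> pa_lang A \<subseteq> lists \<Sigma>"
proof
  fix w assume A: "is_pa \<Sigma> A" and "w \<in> pa_lang A"
  then obtain rs where rs: "\<And>i. i < length w \<Longrightarrow> rs ! i \<in> trans A \<and> lbl (rs ! i) = w ! i"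
    by (auto simp: pa_lang_def fin_run_def)
  have "w ! i \<in> \<Sigma>" if "i < length w" for i
    using rs[OF that] A by (cases "rs ! i") (auto simp: lbl_def dest: is_pa_transD)
  then show "w \<in> lists \<Sigma>"
    by (auto simp: in_set_conv_nth)
qed

lemma nfa_lang_subset_lists: "is_nfa \<Sigma> N \<Longrightarrow> nfa_lang N \<subseteq> lists \<Sigma>"
proof
  fix w assume N: "is_nfa \<Sigma> N" and "w \<in> nfa_lang N"
  then obtain ps where "\<And>i. i < length w \<Longrightarrow> (ps ! i, w ! i, ps ! Suc i) \<in> ndelta N"
    by (auto simp: nfa_lang_def)
  then have "w ! i \<in> \<Sigma>" if "i < length w" for i
    using that N unfolding is_nfa_def by blast
  then show "w \<in> lists \<Sigma>"
    by (auto simp: in_set_conv_nth)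
qed

section \<open>Gluing blocks\<close>

text \<open>\<open>g 0\<close> is the length of the word from \<open>U\<close> and
  \<open>g i\<close> the start of block \<open>i\<close>. Strict monotonicity of \<open>g\<close>
  takes over the exclusion of empty blocks.\<close>

lemma conc_omega_pow_iff:
  "\<alpha> \<in> conc_omega U (omega_pow V) \<longleftrightarrow>
    (\<exists>g. strict_mono g \<and> map \<alpha> [0..<g 0] \<in> U \<and> (\<forall>i. map \<alpha> [g i..<g (Suc i)] \<in> V))"
    (is "_ \<longleftrightarrow> ?R")
proof
  assume "\<alpha> \<in> conc_omega U (omega_pow V)"
  then obtain u \<beta> f where u: "u \<in> U" and f: "strict_mono f" "f 0 = 0"
    "\<And>i. map \<beta> [f i..<f (Suc i)] \<in> V"
    and \<alpha>: "\<alpha> = (\<lambda>n. if n < length u then u ! n else \<beta> (n - length u))"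
    unfolding conc_omega_def omega_pow_def by blast
  let ?g = "\<lambda>i. length u + f i"
  have "strict_mono ?g" using f(1) by (simp add: strict_mono_def)
  moreover have "map \<alpha> [0..<?g 0] = u"
    by (rule nth_equalityI) (simp_all add: f(2) \<alpha>)
  moreover have "map \<alpha> [?g i..<?g (Suc i)] = map \<beta> [f i..<f (Suc i)]" for i
    by (rule nth_equalityI) (simp_all add: \<alpha>)
  ultimately show ?R using u f(3) by (intro exI[of _ ?g]) simp
next
  assume ?R
  then obtain g where g: "strict_mono g" "map \<alpha> [0..<g 0] \<in> U"
    "\<And>i. map \<alpha> [g i..<g (Suc i)] \<in> V" by blast
  have le: "g 0 \<le> g i" for i using g(1) by (simp add: strict_mono_less_eq)
  have lt: "g i < g (Suc i)" for i using g(1) by (simp add: strict_mono_less)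
  let ?f = "\<lambda>i. g i - g 0" and ?\<beta> = "\<lambda>n. \<alpha> (n + g 0)"
  have "strict_mono ?f"
    using lt le by (simp add: strict_mono_Suc_iff diff_less_mono)
  moreover have "map ?\<beta> [?f i..<?f (Suc i)] = map \<alpha> [g i..<g (Suc i)]" for i
    using le[of i] le[of "Suc i"] by (intro nth_equalityI) (simp_all add: add.commute)
  moreover have "?f i < ?f (Suc i)" for i
    using lt le by (simp add: diff_less_mono)
  ultimately have "?\<beta> \<in> omega_pow V"
    using g(3) unfolding omega_pow_def mem_Collect_eq
    by (intro exI[of _ ?f] conjI allI DiffI)
      (simp_all add: not_le lt order.strict_trans1[OF le0 lt] del: map_eq_conv)
  moreover have "\<alpha> = (\<lambda>n. if n < length (map \<alpha> [0..<g 0]) then map \<alpha> [0..<g 0] ! n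
      else ?\<beta> (n - length (map \<alpha> [0..<g 0])))"
    by (rule ext) simp
  ultimately show "\<alpha> \<in> conc_omega U (omega_pow V)"
    unfolding conc_omega_def mem_Collect_eq using g(2) by (intro bexI)
qed

text \<open>Blocks are half-open, so for strictly increasing \<open>g\<close> each position from
  \<open>g 0\<close> on lies in exactly one block and the description denotes it. A cut takes its
  value from the block that it opens.\<close>

definition glue :: "(nat \<Rightarrow> nat) \<Rightarrow> (nat \<Rightarrow> 'b) \<Rightarrow> (nat \<Rightarrow> nat \<Rightarrow> 'b) \<Rightarrow> nat \<Rightarrow> 'b" where
  "glue g s t k = (if k < g 0 then s k else t (THE i. g i \<le> k \<and> k < g (Suc i)) k)"

lemma glue_prefix: "k < g 0 \<Longrightarrow> glue g s t k = s k"
  by (simp add: glue_def)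

lemma glue_block:
  assumes "strict_mono g" and "g i \<le> k" and "k < g (Suc i)"
  shows "glue g s t k = t i k"
proof -
  have "j = i" if "g j \<le> k \<and> k < g (Suc j)" for j
    using that assms strict_mono_less[OF assms(1)] 
    by (meson le_less_trans less_Suc_eq_le order_antisym)
  then have "(THE j. g j \<le> k \<and> k < g (Suc j)) = i"
    using assms by blast
  moreover have "g 0 \<le> k" using assms strict_mono_less_eq[OF assms(1), of 0 i] by simp
  ultimately show ?thesis by (simp add: glue_def)
qed

lemma block_cases:
  fixes g :: "nat \<Rightarrow> nat"
  assumes "strict_mono g"
  obtains "k < g 0" | i where "g i \<le> k" and "k < g (Suc i)"
proof (cases "k < g 0")
  case False
  have "\<exists>i. k < g i" using strict_mono_imp_increasing[OF assms, of "Suc k"] by (intro exI[of _ "Suc k"]) simp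
  define n where "n = (LEAST i. k < g i)"
  have n: "k < g n" unfolding n_def using \<open>\<exists>i. k < g i\<close> by (rule LeastI_ex)
  then obtain i where "n = Suc i" using False by (cases n) auto
  moreover from this have "\<not> k < g i" unfolding n_def using not_less_Least by (metis lessI)
  ultimately show thesis using n that(2)[of i] by simp
qed (use that in blast)

text \<open>The last transition of a block leads to the state at the next cut, which
  \<open>glue\<close> assigns to the following block; agreement of the pieces at the cuts closes
  this gap.\<close>

lemma glue_closed:
  assumes "strict_mono g" and "g i \<le> k" and "k \<le> g (Suc i)"
    and "\<And>i. t i (g (Suc i)) = t (Suc i) (g (Suc i))"
  shows "glue g s t k = t i k"
proof (cases "k = g (Suc i)")
  case True
  have "g (Suc i) < g (Suc (Suc i))" using assms(1) by (simp add: strict_mono_less)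
  then show ?thesis using True glue_block[OF assms(1), of "Suc i" k s t] assms(4) by simp
qed (use assms glue_block in \<open>metis le_neq_implies_less\<close>)

section \<open>From limit acceptance to concatenations\<close>

lemma lim_sum_eq_psum:
  assumes "\<And>k j. m \<le> k \<Longrightarrow> j < d \<Longrightarrow> v k ! j = 0"
  shows "lim_sum d v = map enat (psum d v m)"
proof (rule nth_equalityI)
  fix j assume "j < length (lim_sum d v)"
  then have j: "j < d" by (simp add: lim_sum_def)
  have "k < m" if "v k ! j \<noteq> 0" for k
    using assms[OF _ j, of k] that by (cases "k < m") auto
  then have sub: "{k. v k ! j \<noteq> 0} \<subseteq> {..<m}" by blast
  then have "finite {k. v k ! j \<noteq> 0}" by (rule finite_subset) simp
  moreover have "(\<Sum>k | v k ! j \<noteq> 0. v k ! j) = (\<Sum>k<m. v k ! j)"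
    using sub by (intro sum.mono_neutral_left) auto
  ultimately show "lim_sum d v ! j = map enat (psum d v m) ! j"
    using j by (simp add: lim_sum_def del: neq0_conv)
qed (simp add: lim_sum_def)

text \<open>\<open>fin_part\<close> writes 0 for infinity, so sums can be compared with it only
  after the coordinates in \<open>I\<close> have been zeroed as well.\<close>

definition mask :: "nat set \<Rightarrow> nat list \<Rightarrow> nat list" where
  "mask I v = map (\<lambda>j. if j \<in> I then 0 else v ! j) [0..<length v]"

lemma length_mask [simp]: "length (mask I v) = length v"
  by (simp add: mask_def)

lemma psum_mask:
  assumes "\<And>k. k < m \<Longrightarrow> length (v k) = d"
  shows "psum d (\<lambda>k. mask I (v k)) m = mask I (psum d v m)"
  using assms by (intro nth_equalityI) (auto simp: mask_def)

text \<open>From \<open>m\<close> on only coordinates in \<open>I\<close> change, so outside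
  \<open>I\<close> the limit is already reached at \<open>m\<close>. This lets a finite prefix
  decide about a limit.\<close>

lemma lim_sum_mask:
  assumes "I \<subseteq> {..<d}"
    and "\<And>k j. m \<le> k \<Longrightarrow> j < d \<Longrightarrow> j \<notin> I \<Longrightarrow> v k ! j = 0"
    and "\<And>j. j \<in> I \<Longrightarrow> infinite {k. v k ! j \<noteq> 0}"
  shows "inf_pos (lim_sum d v) = I" and "fin_part (lim_sum d v) = mask I (psum d v m)"
proof -
  have len: "length (lim_sum d v) = d" by (simp add: lim_sum_def)
  have outside: "lim_sum d v ! j = enat (\<Sum>k<m. v k ! j)" if "j < d" "j \<notin> I" for j
  proof -
    have "k < m" if "v k ! j \<noteq> 0" for k
      using assms(2)[OF _ \<open>j < d\<close> \<open>j \<notin> I\<close>, of k] that by (cases "k < m") auto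
    then have sub: "{k. v k ! j \<noteq> 0} \<subseteq> {..<m}" by blast
    then have "finite {k. v k ! j \<noteq> 0}" by (rule finite_subset) simp
    moreover have "(\<Sum>k | v k ! j \<noteq> 0. v k ! j) = (\<Sum>k<m. v k ! j)"
      using sub by (intro sum.mono_neutral_left) auto
    ultimately show ?thesis using that by (simp add: lim_sum_def del: neq0_conv)
  qed
  have inside: "lim_sum d v ! j = \<infinity>" if "j \<in> I" for j
    using that assms(1,3) by (auto simp: lim_sum_def)
  show "inf_pos (lim_sum d v) = I"
    using outside inside assms(1) len unfolding inf_pos_def by (auto; metis enat.distinct(2))
  show "fin_part (lim_sum d v) = mask I (psum d v m)"
  proof (rule nth_equalityI)
    fix j assume "j < length (fin_part (lim_sum d v))"
    then show "fin_part (lim_sum d v) ! j = mask I (psum d v m) ! j"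
      using outside inside len by (cases "j \<in> I") (simp_all add: fin_part_def mask_def)
  qed (simp add: fin_part_def len)
qed

definition prefix_pa :: "('a, enat) pa \<Rightarrow> nat \<Rightarrow> nat set \<Rightarrow> ('a, nat) pa" where
  "prefix_pa A f I = \<lparr>states = states A, dim = dim A, init = init A,
     trans = (\<lambda>(p, x, v, q). (p, x, mask I v, q)) ` trans A,
     final = {f}, constr = fin_part ` {c \<in> constr A. inf_pos c = I}\<rparr>"

lemma is_pa_prefix_pa:
  assumes "is_pa \<Sigma> A" and "f \<in> final A"
  shows "is_pa \<Sigma> (prefix_pa A f I)"
  using assms by (auto simp: is_pa_def prefix_pa_def semilinear_fin_part)

lemma prefix_in_prefix_pa_iff:
  assumes A: "is_pa \<Sigma> A" and f: "f \<in> final A"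
  shows "map \<alpha> [0..<m] \<in> pa_lang (prefix_pa A f I) \<longleftrightarrow> (\<exists>s v. s 0 = init A \<and>
    (\<forall>k<m. (s k, \<alpha> k, v k, s (Suc k)) \<in> trans A) \<and> s m = f \<and>
    (\<exists>c \<in> constr A. inf_pos c = I \<and> fin_part c = mask I (psum (dim A) v m)))"
    (is "_ \<longleftrightarrow> ?R")
  unfolding prefix_in_pa_lang_iff[OF is_pa_prefix_pa[OF A f]]
proof
  assume "\<exists>s v. s 0 = init (prefix_pa A f I) \<and>
    (\<forall>k<m. (s k, \<alpha> k, v k, s (Suc k)) \<in> trans (prefix_pa A f I)) \<and> s m \<in> final (prefix_pa A f I) \<and>
    psum (dim (prefix_pa A f I)) v m \<in> constr (prefix_pa A f I)"
  then obtain s u where s: "s 0 = init A" "s m = f"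
    and tr: "\<And>k. k < m \<Longrightarrow> \<exists>v. (s k, \<alpha> k, v, s (Suc k)) \<in> trans A \<and> u k = mask I v"
    and c: "\<exists>c \<in> constr A. inf_pos c = I \<and> fin_part c = psum (dim A) u m"
    unfolding prefix_pa_def by force
  \<comment> \<open>Different vectors may have the same mask, so a preimage is chosen at each
    position.\<close>
  from tr obtain v where v: "\<And>k. k < m \<Longrightarrow> (s k, \<alpha> k, v k, s (Suc k)) \<in> trans A \<and> u k = mask I (v k)"
    by metis
  have "psum (dim A) u m = psum (dim A) (\<lambda>k. mask I (v k)) m"
    using v by (intro psum_cong) simp
  also have "\<dots> = mask I (psum (dim A) v m)"
    using v is_pa_transD[OF A] by (intro psum_mask) blast
  finally show ?R using s c v by (intro exI[of _ s] exI[of _ v]) simp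
next
  assume ?R
  then obtain s v where s: "s 0 = init A" "s m = f"
    and tr: "\<And>k. k < m \<Longrightarrow> (s k, \<alpha> k, v k, s (Suc k)) \<in> trans A"
    and c: "\<exists>c \<in> constr A. inf_pos c = I \<and> fin_part c = mask I (psum (dim A) v m)"
    by blast
  have "psum (dim A) (\<lambda>k. mask I (v k)) m = mask I (psum (dim A) v m)"
    using tr is_pa_transD[OF A] by (intro psum_mask) blast
  moreover have "(s k, \<alpha> k, mask I (v k), s (Suc k)) \<in> (\<lambda>(p, x, v, q). (p, x, mask I v, q)) ` trans A"
    if "k < m" for k
    using tr[OF that] by force
  ultimately show "\<exists>s v. s 0 = init (prefix_pa A f I) \<and>
    (\<forall>k<m. (s k, \<alpha> k, v k, s (Suc k)) \<in> trans (prefix_pa A f I)) \<and> s m \<in> final (prefix_pa A f I) \<and>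
    psum (dim (prefix_pa A f I)) v m \<in> constr (prefix_pa A f I)"
    using s c unfolding prefix_pa_def
    by (intro exI[of _ s] exI[of _ "\<lambda>k. mask I (v k)"]) (force simp: image_iff)
qed

text \<open>The bit list of a state records which coordinates have been incremented since the start.\<close>

definition loop_nfa :: "('a, enat) pa \<Rightarrow> nat \<Rightarrow> nat set \<Rightarrow> 'a nfa" where
  "loop_nfa A f I = \<lparr>
     nstates = to_nat ` (states A \<times> {bs :: bool list. length bs = dim A}),
     ninit = to_nat (f, replicate (dim A) False),
     ndelta = {(to_nat (p, bs), x, to_nat (q, map (\<lambda>j. bs ! j \<or> v ! j \<noteq> 0) [0..<dim A])) | p bs x v q.
       (p, x, v, q) \<in> trans A \<and> length bs = dim A \<and> (\<forall>j<dim A. j \<notin> I \<longrightarrow> v ! j = 0)},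
     nfinal = {to_nat (f, bs) | bs. length bs = dim A \<and> (\<forall>j\<in>I. bs ! j)}\<rparr>"

lemma is_nfa_loop_nfa:
  assumes "is_pa \<Sigma> A" and "f \<in> final A"
  shows "is_nfa \<Sigma> (loop_nfa A f I)"
proof -
  have "finite {bs :: bool list. length bs = dim A}"
    using finite_lists_length_eq[of "UNIV :: bool set" "dim A"] by simp
  then show ?thesis
    using assms by (auto simp: is_nfa_def loop_nfa_def dest: is_pa_transD[OF assms(1)]) (auto simp: is_pa_def)
qed

lemma factor_in_loop_nfa_iff:
  assumes "a \<le> b" and I: "I \<subseteq> {..<dim A}"
  shows "map \<alpha> [a..<b] \<in> nfa_lang (loop_nfa A f I) \<longleftrightarrow> (\<exists>s v. s a = f \<and> s b = f \<and>
    (\<forall>k. a \<le> k \<and> k < b \<longrightarrow> (s k, \<alpha> k, v k, s (Suc k)) \<in> trans A \<and>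
      (\<forall>j<dim A. j \<notin> I \<longrightarrow> v k ! j = 0)) \<and>
    (\<forall>j\<in>I. \<exists>k. a \<le> k \<and> k < b \<and> v k ! j \<noteq> 0))" (is "_ \<longleftrightarrow> ?R")
  unfolding factor_in_nfa_lang_iff[OF assms(1)]
proof
  assume "\<exists>t. t a = ninit (loop_nfa A f I) \<and>
    (\<forall>k. a \<le> k \<and> k < b \<longrightarrow> (t k, \<alpha> k, t (Suc k)) \<in> ndelta (loop_nfa A f I)) \<and>
    t b \<in> nfinal (loop_nfa A f I)"
  then obtain t bs where t: "t a = to_nat (f, replicate (dim A) False)"
    "t b = to_nat (f, bs)" "\<forall>j\<in>I. bs ! j"
    and tr: "\<And>k. a \<le> k \<Longrightarrow> k < b \<Longrightarrow> (t k, \<alpha> k, t (Suc k)) \<in> ndelta (loop_nfa A f I)"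
    by (auto simp: loop_nfa_def)
  define s where "s k = fst (from_nat (t k) :: nat \<times> bool list)" for k
  define h where "h k = snd (from_nat (t k) :: nat \<times> bool list)" for k
  have "\<exists>v. (s k, \<alpha> k, v, s (Suc k)) \<in> trans A \<and> (\<forall>j<dim A. j \<notin> I \<longrightarrow> v ! j = 0) \<and>
      (\<forall>j<dim A. h (Suc k) ! j \<longleftrightarrow> h k ! j \<or> v ! j \<noteq> 0)" if "a \<le> k" "k < b" for k
    using tr[OF that] by (auto simp: loop_nfa_def s_def h_def)
  then obtain v where v: "\<And>k. a \<le> k \<Longrightarrow> k < b \<Longrightarrow> (s k, \<alpha> k, v k, s (Suc k)) \<in> trans A \<and>
      (\<forall>j<dim A. j \<notin> I \<longrightarrow> v k ! j = 0) \<and>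
      (\<forall>j<dim A. h (Suc k) ! j \<longleftrightarrow> h k ! j \<or> v k ! j \<noteq> 0)"
    by metis
  \<comment> \<open>All bits are False at \<open>a\<close>, so a bit set at \<open>n\<close> was
    switched on by an increment at some position from \<open>a\<close> on and before
    \<open>n\<close>.\<close>
  have "a \<le> n \<Longrightarrow> n \<le> b \<Longrightarrow> j < dim A \<Longrightarrow> h n ! j \<Longrightarrow> \<exists>k. a \<le> k \<and> k < n \<and> v k ! j \<noteq> 0" for n j
  proof (induction n rule: dec_induct)
    case base
    then show ?case using t(1) by (simp add: h_def)
  next
    case (step n)
    then show ?case using v[of n] by (metis Suc_leD Suc_le_lessD less_Suc_eq)
  qed
  moreover have "h b ! j" if "j \<in> I" for j using t that by (simp add: h_def)
  ultimately have "\<exists>k. a \<le> k \<and> k < b \<and> v k ! j \<noteq> 0" if "j \<in> I" for j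
    using that I assms(1) by blast
  moreover have "s a = f" "s b = f" using t by (simp_all add: s_def)
  ultimately show ?R using v by blast
next
  assume ?R
  then obtain s v where s: "s a = f" "s b = f"
    and tr: "\<And>k. a \<le> k \<Longrightarrow> k < b \<Longrightarrow> (s k, \<alpha> k, v k, s (Suc k)) \<in> trans A \<and>
      (\<forall>j<dim A. j \<notin> I \<longrightarrow> v k ! j = 0)"
    and nz: "\<forall>j\<in>I. \<exists>k. a \<le> k \<and> k < b \<and> v k ! j \<noteq> 0"
    by blast
  \<comment> \<open>The bits are determined by the run: bit \<open>j\<close> at \<open>n\<close>
    says whether coordinate \<open>j\<close> was incremented at a position in
    \<open>[a, n)\<close>.\<close>
  define h where "h n = map (\<lambda>j. \<exists>k. a \<le> k \<and> k < n \<and> v k ! j \<noteq> 0) [0..<dim A]" for n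
  have h: "h (Suc k) = map (\<lambda>j. h k ! j \<or> v k ! j \<noteq> 0) [0..<dim A]" if "a \<le> k" for k
    using that unfolding h_def by (auto simp: less_Suc_eq)
  have "to_nat (s a, h a) = ninit (loop_nfa A f I)"
    by (auto simp: loop_nfa_def s h_def list_eq_iff_nth_eq)
  moreover have "(to_nat (s k, h k), \<alpha> k, to_nat (s (Suc k), h (Suc k))) \<in> ndelta (loop_nfa A f I)"
    if "a \<le> k" "k < b" for k
  proof -
    have "length (h k) = dim A" by (simp add: h_def)
    then show ?thesis
      unfolding loop_nfa_def nfa.simps mem_Collect_eq
      using tr[OF that] h[OF that(1)]
      by (intro exI[of _ "s k"] exI[of _ "h k"] exI[of _ "\<alpha> k"] exI[of _ "v k"]
          exI[of _ "s (Suc k)"]) simp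
  qed
  moreover have "to_nat (s b, h b) \<in> nfinal (loop_nfa A f I)"
    using nz I by (auto simp: loop_nfa_def s h_def)
  ultimately show "\<exists>t. t a = ninit (loop_nfa A f I) \<and>
    (\<forall>k. a \<le> k \<and> k < b \<longrightarrow> (t k, \<alpha> k, t (Suc k)) \<in> ndelta (loop_nfa A f I)) \<and>
    t b \<in> nfinal (loop_nfa A f I)"
    by (intro exI[of _ "\<lambda>k. to_nat (s k, h k)"]) blast
qed

text \<open>The cuts are visits of \<open>f\<close> past a point \<open>K\<close> where the
  coordinates outside \<open>I\<close> have settled, each so far beyond the previous one that every
  coordinate in \<open>I\<close> is incremented in between.\<close>

lemma lpba_lang_subset_UN:
  assumes A: "is_pa \<Sigma> A" and "\<alpha> \<in> lpba_lang A"
  shows "\<exists>f\<in>final A. \<exists>I\<subseteq>{..<dim A}.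
    \<alpha> \<in> conc_omega (pa_lang (prefix_pa A f I)) (omega_pow (nfa_lang (loop_nfa A f I)))"
proof -
  let ?d = "dim A"
  obtain s v where path: "inf_path A \<alpha> s v" and inf: "\<exists>\<^sub>\<infinity>k. s k \<in> final A"
    and C: "lim_sum ?d v \<in> constr A"
    using assms(2) unfolding lpba_lang_iff by blast
  note tr = inf_pathD[OF path]
  have "finite (final A)" using A finite_subset by (auto simp: is_pa_def)
  moreover have "infinite (\<Union>f\<in>final A. {k. s k = f})"
  proof -
    have "(\<Union>f\<in>final A. {k. s k = f}) = {k. s k \<in> final A}" by auto
    then show ?thesis using inf by (simp add: INFM_iff_infinite)
  qed
  \<comment> \<open>Finitely many final states share infinitely many visits, so one of them
    recurs.\<close>
  ultimately obtain f where f: "f \<in> final A" "infinite {k. s k = f}" by blast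
  define I where "I = {j. j < ?d \<and> infinite {k. v k ! j \<noteq> 0}}"
  have I: "I \<subseteq> {..<?d}" by (auto simp: I_def)
  have "finite (\<Union>j\<in>{..<?d} - I. {k. v k ! j \<noteq> 0})" by (auto simp: I_def)
  then obtain K where "\<forall>k \<in> (\<Union>j\<in>{..<?d} - I. {k. v k ! j \<noteq> 0}). k < K"
    using finite_nat_set_iff_bounded by blast
  then have K: "v k ! j = 0" if "K \<le> k" "j < ?d" "j \<notin> I" for k j
    using that by force
  have next_f: "\<exists>n>m. s n = f" for m
    using f(2) unfolding infinite_nat_iff_unbounded by blast
  have "\<exists>n>m. s n = f \<and> (\<forall>j\<in>I. \<exists>k. m \<le> k \<and> k < n \<and> v k ! j \<noteq> 0)" for m
  proof -
    have "\<forall>j\<in>I. \<exists>k\<ge>m. v k ! j \<noteq> 0"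
      unfolding I_def infinite_nat_iff_unbounded_le by blast
    then obtain \<kappa> where \<kappa>: "\<And>j. j \<in> I \<Longrightarrow> m \<le> \<kappa> j \<and> v (\<kappa> j) ! j \<noteq> 0" by metis
    \<comment> \<open>\<open>I\<close> is finite, so one witness position per coordinate can be
      bounded by a common \<open>M\<close>, and \<open>f\<close> is visited again after
      \<open>M\<close>.\<close>
    have "finite (insert m (\<kappa> ` I))" using I finite_subset by blast
    then obtain M where M: "\<forall>x \<in> insert m (\<kappa> ` I). x < M"
      unfolding finite_nat_set_iff_bounded by blast
    obtain n where "n > M" "s n = f" using next_f by blast
    with M \<kappa> show ?thesis by (intro exI[of _ n]) (auto, metis less_trans)
  qed
  then have step: "\<exists>y. (s y = f \<and> K \<le> y) \<and> x < y \<and>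
      (\<forall>j\<in>I. \<exists>k. x \<le> k \<and> k < y \<and> v k ! j \<noteq> 0)" if "s x = f \<and> K \<le> x" for x
    using that by (meson le_trans less_imp_le)
  moreover have "\<exists>x. s x = f \<and> K \<le> x" using next_f[of K] less_imp_le by blast
  ultimately obtain g where g: "\<And>n. s (g n) = f \<and> K \<le> g n"
    "\<And>n. g n < g (Suc n) \<and> (\<forall>j\<in>I. \<exists>k. g n \<le> k \<and> k < g (Suc n) \<and> v k ! j \<noteq> 0)"
    using dependent_nat_choice[of "\<lambda>_ x. s x = f \<and> K \<le> x"
      "\<lambda>_ x y. x < y \<and> (\<forall>j\<in>I. \<exists>k. x \<le> k \<and> k < y \<and> v k ! j \<noteq> 0)"] by blast
  have "strict_mono g" using g(2) by (simp add: strict_mono_Suc_iff)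
  moreover have "map \<alpha> [0..<g 0] \<in> pa_lang (prefix_pa A f I)"
  proof -
    have *: "v k ! j = 0" if "g 0 \<le> k" "j < ?d" "j \<notin> I" for k j
      using K[of k j] that g(1)[of 0] by simp
    have **: "infinite {k. v k ! j \<noteq> 0}" if "j \<in> I" for j
      using that by (simp add: I_def)
    show ?thesis
      unfolding prefix_in_prefix_pa_iff[OF A f(1)]
      using path tr C g(1) lim_sum_mask[OF I * **, of "g 0"]
      by (intro exI[of _ s] exI[of _ v]) (auto simp: inf_path_def)
  qed
  moreover have "map \<alpha> [g i..<g (Suc i)] \<in> nfa_lang (loop_nfa A f I)" for i
  proof -
    have "g i \<le> g (Suc i)" using g(2)[of i] by simp
    moreover have "v k ! j = 0" if "g i \<le> k" "j < ?d" "j \<notin> I" for k j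
      using K[of k j] that g(1)[of i] by simp
    ultimately show ?thesis
      using g tr by (subst factor_in_loop_nfa_iff[OF _ I]) blast+
  qed
  ultimately show ?thesis
    using f(1) I unfolding conc_omega_pow_iff by blast
qed

text \<open>All pieces meet in \<open>f\<close> at the cuts, so they glue to a run. Coordinates in
  \<open>I\<close> grow in every block and the others are frozen after the prefix; hence the vector
  \<open>c\<close> whose finite part the prefix matches is the limit of the glued run.\<close>

lemma UN_subset_lpba_lang:
  assumes A: "is_pa \<Sigma> A" and f: "f \<in> final A" and I: "I \<subseteq> {..<dim A}"
    and "\<alpha> \<in> conc_omega (pa_lang (prefix_pa A f I)) (omega_pow (nfa_lang (loop_nfa A f I)))"
  shows "\<alpha> \<in> lpba_lang A"
proof -
  let ?d = "dim A"
  obtain g where g: "strict_mono g" and pre: "map \<alpha> [0..<g 0] \<in> pa_lang (prefix_pa A f I)"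
    and blocks: "\<And>i. map \<alpha> [g i..<g (Suc i)] \<in> nfa_lang (loop_nfa A f I)"
    using assms(4) unfolding conc_omega_pow_iff by blast
  obtain s v c where s: "s 0 = init A" "s (g 0) = f"
    and str: "\<And>k. k < g 0 \<Longrightarrow> (s k, \<alpha> k, v k, s (Suc k)) \<in> trans A"
    and c: "c \<in> constr A" "inf_pos c = I" "fin_part c = mask I (psum ?d v (g 0))"
    using pre unfolding prefix_in_prefix_pa_iff[OF A f] by blast
  have "\<forall>i. \<exists>t u. t (g i) = f \<and> t (g (Suc i)) = f \<and>
    (\<forall>k. g i \<le> k \<and> k < g (Suc i) \<longrightarrow> (t k, \<alpha> k, u k, t (Suc k)) \<in> trans A \<and>
      (\<forall>j<?d. j \<notin> I \<longrightarrow> u k ! j = 0)) \<and>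
    (\<forall>j\<in>I. \<exists>k. g i \<le> k \<and> k < g (Suc i) \<and> u k ! j \<noteq> 0)"
    using blocks factor_in_loop_nfa_iff[OF _ I] g by (simp add: strict_mono_less_eq)
  then obtain t u where t: "\<And>i. t i (g i) = f" "\<And>i. t i (g (Suc i)) = f"
    and tu: "\<And>i k. g i \<le> k \<Longrightarrow> k < g (Suc i) \<Longrightarrow> (t i k, \<alpha> k, u i k, t i (Suc k)) \<in> trans A"
      "\<And>i k j. g i \<le> k \<Longrightarrow> k < g (Suc i) \<Longrightarrow> j < ?d \<Longrightarrow> j \<notin> I \<Longrightarrow> u i k ! j = 0"
      "\<And>i j. j \<in> I \<Longrightarrow> \<exists>k. g i \<le> k \<and> k < g (Suc i) \<and> u i k ! j \<noteq> 0"
    by metis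
  define S where "S = glue g s t"
  define V where "V = glue g v u"
  have S_pre: "S k = s k" if "k \<le> g 0" for k
  proof (cases "k = g 0")
    case True
    then show ?thesis
      using glue_closed[OF g, of 0 k t s] t s(2) g by (simp add: S_def strict_mono_less_eq)
  qed (use that in \<open>simp add: S_def glue_prefix\<close>)
  have S_blk: "S k = t i k" if "g i \<le> k" "k \<le> g (Suc i)" for i k
    unfolding S_def by (rule glue_closed[OF g that]) (simp add: t)
  have V_pre: "V k = v k" if "k < g 0" for k
    using that by (simp add: V_def glue_prefix)
  have V_blk: "V k = u i k" if "g i \<le> k" "k < g (Suc i)" for i k
    unfolding V_def using glue_block[OF g that] .
  have "(S k, \<alpha> k, V k, S (Suc k)) \<in> trans A" for k
  proof (rule block_cases[OF g, of k])
    assume "k < g 0"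
    then show ?thesis using str by (simp add: S_pre V_pre)
  next
    fix i assume "g i \<le> k" "k < g (Suc i)"
    then show ?thesis using tu(1)[of i k] by (simp add: S_blk[of i] V_blk[of i])
  qed
  then have path: "inf_path A \<alpha> S V"
    using s(1) S_pre[of 0] by (simp add: inf_path_def)
  have "S (g i) = f" for i
    using S_blk[of i "g i"] t g by (simp add: strict_mono_less_eq)
  then have "g ` UNIV \<subseteq> {k. S k \<in> final A}" using f by auto
  moreover have "infinite (g ` UNIV)"
    using strict_mono_imp_inj_on[OF g] by (simp add: finite_image_iff)
  ultimately have inf: "\<exists>\<^sub>\<infinity>k. S k \<in> final A"
    unfolding INFM_iff_infinite using infinite_super by blast
  have zero: "V k ! j = 0" if "g 0 \<le> k" "j < ?d" "j \<notin> I" for k j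
  proof (rule block_cases[OF g, of k])
    fix i assume "g i \<le> k" "k < g (Suc i)"
    then show ?thesis using tu(2)[of i k j] that by (simp add: V_blk)
  qed (use that in simp)
  \<comment> \<open>Block \<open>m\<close> has a nonzero entry at a position that is at least
    \<open>g m\<close>, hence at least \<open>m\<close>, so such positions are unbounded.\<close>
  have infI: "infinite {k. V k ! j \<noteq> 0}" if "j \<in> I" for j
    unfolding infinite_nat_iff_unbounded_le
  proof
    fix m
    obtain k where k: "g m \<le> k" "k < g (Suc m)" "u m k ! j \<noteq> 0" using tu(3)[OF \<open>j \<in> I\<close>] by blast
    moreover have "m \<le> g m" using strict_mono_imp_increasing[OF g] .
    ultimately show "\<exists>n\<ge>m. n \<in> {k. V k ! j \<noteq> 0}"
      using V_blk[of m k] by (intro exI[of _ k]) simp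
  qed
  have "c = lim_sum ?d V"
  proof (rule fin_part_inject)
    show "length c = length (lim_sum ?d V)"
      using A c(1) semilinear_length by (auto simp: is_pa_def lim_sum_def)
    show "inf_pos c = inf_pos (lim_sum ?d V)"
      using c(2) lim_sum_mask(1)[OF I zero infI] by simp
    show "fin_part c = fin_part (lim_sum ?d V)"
      using c(3) lim_sum_mask(2)[OF I zero infI] psum_cong[of "g 0" V v] V_pre by simp
  qed
  then show ?thesis
    unfolding lpba_lang_iff using path inf c(1) by blast
qed

section \<open>From reachability to limit acceptance\<close>

text \<open>The flag of a state records whether the constraint has already been tested; afterwards
  the run no longer counts.\<close>

definition freeze_pa :: "('a, nat) pa \<Rightarrow> ('a, enat) pa" where
  "freeze_pa A = \<lparr>states = to_nat ` ((UNIV :: bool set) \<times> states A), dim = dim A,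
     init = to_nat (False, init A),
     trans = {(to_nat (b, p), x, if b then replicate (dim A) 0 else v, to_nat (c, q)) | b c p x v q.
       (p, x, v, q) \<in> trans A \<and> (b \<longrightarrow> c) \<and> (\<not> b \<and> c \<longrightarrow> q \<in> final A)},
     final = {to_nat (True, f) | f. f \<in> final A}, constr = map enat ` constr A\<rparr>"

lemma is_pa_freeze_pa:
  assumes A: "is_pa \<Sigma> A"
  shows "is_pa \<Sigma> (freeze_pa A)"
proof -
  have "trans (freeze_pa A) \<subseteq> (\<lambda>((p, x, v, q), b, c).
      (to_nat (b, p), x, if b then replicate (dim A) 0 else v, to_nat (c, q)))
      ` (trans A \<times> (UNIV :: (bool \<times> bool) set))"
  proof
    fix e assume "e \<in> trans (freeze_pa A)"
    then obtain b c :: bool and p x v q where "(p, x, v, q) \<in> trans A"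
      "e = (to_nat (b, p), x, if b then replicate (dim A) 0 else v, to_nat (c, q))"
      unfolding freeze_pa_def pa.simps by blast
    then show "e \<in> (\<lambda>((p, x, v, q), b, c).
      (to_nat (b, p), x, if b then replicate (dim A) 0 else v, to_nat (c, q)))
      ` (trans A \<times> (UNIV :: (bool \<times> bool) set))"
      by (intro image_eqI[of _ _ "((p, x, v, q), b, c)"]) simp_all
  qed
  moreover have "finite (trans A \<times> (UNIV :: (bool \<times> bool) set))"
    using A by (simp add: is_pa_def)
  ultimately have "finite (trans (freeze_pa A))"
    using finite_surj by blast
  moreover have "trans (freeze_pa A) \<subseteq> {(p, x, v, q). p \<in> states (freeze_pa A) \<and> x \<in> \<Sigma> \<and>
      length v = dim (freeze_pa A) \<and> q \<in> states (freeze_pa A)}"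
    unfolding freeze_pa_def by (auto dest: is_pa_transD[OF A])
  ultimately show ?thesis
    using A unfolding is_pa_def by (auto simp: freeze_pa_def semilinear_map_enat)
qed

text \<open>With the flag set all vectors are zero, so the limit is the finite sum at the moment of
  the switch. Final states carry the flag, so an accepting run must switch, and it can do so only on
  entering a final state of \<open>A\<close>, which is where the reachability condition is
  met.\<close>

lemma lpba_lang_freeze_pa:
  assumes A: "is_pa \<Sigma> A"
  shows "lpba_lang (freeze_pa A) = rpba_lang A"
proof (intro equalityI subsetI)
  let ?d = "dim A" let ?B = "freeze_pa A"
  fix \<alpha> assume "\<alpha> \<in> rpba_lang A"
  then obtain s v i where path: "inf_path A \<alpha> s v" and i: "s (Suc i) \<in> final A"
    "psum ?d v (Suc i) \<in> constr A" and inf: "\<exists>\<^sub>\<infinity>k. s k \<in> final A"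
    unfolding rpba_lang_iff[OF A] by blast
  \<comment> \<open>The flag is raised on arrival at position \<open>Suc i\<close>; transition
    \<open>i\<close> is the last one that counts.\<close>
  define S where "S k = to_nat (i < k, s k)" for k
  define V where "V k = (if i < k then replicate ?d 0 else v k)" for k
  have "(S k, \<alpha> k, V k, S (Suc k)) \<in> trans ?B" for k
    unfolding freeze_pa_def pa.simps mem_Collect_eq
  proof (intro exI conjI)
    show "(s k, \<alpha> k, v k, s (Suc k)) \<in> trans A" using inf_pathD[OF path] .
    show "(S k, \<alpha> k, V k, S (Suc k)) = (to_nat (i < k, s k), \<alpha> k,
        if i < k then replicate ?d 0 else v k, to_nat (i < Suc k, s (Suc k)))"
      by (simp add: S_def V_def)
    show "\<not> i < k \<and> i < Suc k \<longrightarrow> s (Suc k) \<in> final A"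
      using i(1) by (auto simp: less_Suc_eq)
  qed auto
  then have "inf_path ?B \<alpha> S V"
    using path by (simp add: inf_path_def S_def freeze_pa_def)
  moreover have "\<exists>\<^sub>\<infinity>k. S k \<in> final ?B"
    unfolding INFM_nat
  proof
    fix m
    obtain k where "k > max m i" "s k \<in> final A" using inf unfolding INFM_nat by blast
    then show "\<exists>n>m. S n \<in> final ?B"
      by (intro exI[of _ k]) (auto simp: S_def freeze_pa_def)
  qed
  moreover have "lim_sum (dim ?B) V \<in> constr ?B"
  proof -
    have "lim_sum ?d V = map enat (psum ?d V (Suc i))"
      by (rule lim_sum_eq_psum) (simp add: V_def)
    also have "psum ?d V (Suc i) = psum ?d v (Suc i)"
      by (rule psum_cong) (simp add: V_def)
    finally show ?thesis using i(2) by (simp add: freeze_pa_def)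
  qed
  ultimately show "\<alpha> \<in> lpba_lang ?B"
    unfolding lpba_lang_iff by blast
next
  let ?d = "dim A" let ?B = "freeze_pa A"
  fix \<alpha> assume "\<alpha> \<in> lpba_lang ?B"
  then obtain S V where path: "inf_path ?B \<alpha> S V" and inf: "\<exists>\<^sub>\<infinity>k. S k \<in> final ?B"
    and C: "lim_sum ?d V \<in> map enat ` constr A"
    unfolding lpba_lang_iff by (auto simp: freeze_pa_def)
  define b where "b k = fst (from_nat (S k) :: bool \<times> nat)" for k
  define s where "s k = snd (from_nat (S k) :: bool \<times> nat)" for k
  have "\<exists>v. (s k, \<alpha> k, v, s (Suc k)) \<in> trans A \<and> V k = (if b k then replicate ?d 0 else v) \<and>
      (b k \<longrightarrow> b (Suc k)) \<and> (\<not> b k \<and> b (Suc k) \<longrightarrow> s (Suc k) \<in> final A)" for k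
    using inf_pathD[OF path, of k] by (auto simp: freeze_pa_def s_def b_def)
  then obtain v where tr: "\<And>k. (s k, \<alpha> k, v k, s (Suc k)) \<in> trans A"
    and V: "\<And>k. V k = (if b k then replicate ?d 0 else v k)"
    and mono: "\<And>k. b k \<Longrightarrow> b (Suc k)"
    and switch: "\<And>k. \<not> b k \<Longrightarrow> b (Suc k) \<Longrightarrow> s (Suc k) \<in> final A"
    by metis
  have init: "\<not> b 0" "s 0 = init A"
    using path by (simp_all add: inf_path_def freeze_pa_def b_def s_def)
  have fin: "b k \<and> s k \<in> final A" if "S k \<in> final ?B" for k
    using that by (auto simp: freeze_pa_def b_def s_def)
  obtain n where "b n" using inf fin unfolding INFM_nat by blast
  define m where "m = (LEAST k. b k)"
  have "b m" unfolding m_def using \<open>b n\<close> by (rule LeastI)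
  have less: "\<not> b k" if "k < m" for k using that not_less_Least unfolding m_def by blast
  \<comment> \<open>The initial flag is False, so the first flagged position is a successor and the
    test comes after at least one letter.\<close>
  obtain i where i: "m = Suc i" using \<open>b m\<close> init by (cases m) auto
  have ge: "b k" if "m \<le> k" for k
    using that by (induction k rule: dec_induct) (use \<open>b m\<close> mono in auto)
  have "lim_sum ?d V = map enat (psum ?d V (Suc i))"
    by (rule lim_sum_eq_psum) (use ge i V in simp)
  also have "psum ?d V (Suc i) = psum ?d v (Suc i)"
    by (rule psum_cong) (use less i V in simp)
  finally have "psum ?d v (Suc i) \<in> constr A"
    using C by (auto simp: inj_map_eq_map[of enat] inj_def)
  moreover have "s (Suc i) \<in> final A"
    using switch[of i] less[of i] \<open>b m\<close> i by simp
  moreover have "\<exists>\<^sub>\<infinity>k. s k \<in> final A"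
    using inf fin unfolding INFM_nat by blast
  moreover have "inf_path A \<alpha> s v"
    using tr init by (simp add: inf_path_def)
  ultimately show "\<alpha> \<in> rpba_lang A"
    unfolding rpba_lang_iff[OF A] by blast
qed

section \<open>From concatenations to reachability acceptance\<close>

text \<open>No transition enters the fresh initial state \<open>None\<close>, so the component is
  chosen exactly once, by the transition with \<open>c\<close>, which also deposits its index. The
  index keeps the constraint of one component from accepting the sums of another. \<open>D\<close>
  serves as a common upper bound of the dimensions.\<close>

definition union_pa :: "nat set \<Rightarrow> (nat \<Rightarrow> ('a, nat) pa) \<Rightarrow> ('a, nat) pa" where
  "union_pa J A = (let D = (\<Sum>i\<in>J. dim (A i)) in
    \<lparr>states = insert (to_nat (None :: (nat \<times> nat) option)) (\<Union>i\<in>J. (\<lambda>p. to_nat (Some (i, p))) ` states (A i)),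
     dim = Suc D, init = to_nat (None :: (nat \<times> nat) option),
     trans = {(to_nat (if c then None else Some (i, p)), x, pad D (if c then i else 0) v,
         to_nat (Some (i, q))) | c i p x v q.
       i \<in> J \<and> (p, x, v, q) \<in> trans (A i) \<and> (c \<longrightarrow> p = init (A i))},
     final = (\<Union>i\<in>J. (\<lambda>p. to_nat (Some (i, p))) ` final (A i)),
     constr = (\<Union>i\<in>J. pad D i ` constr (A i))\<rparr>)"

lemma union_pa_transE:
  assumes "e \<in> trans (union_pa J A)"
  obtains c i p x v q where "i \<in> J" and "(p, x, v, q) \<in> trans (A i)"
    and "c \<Longrightarrow> p = init (A i)"
    and "e = (to_nat (if c then None else Some (i, p)), x,
      pad (\<Sum>i\<in>J. dim (A i)) (if c then i else 0) v, to_nat (Some (i, q)))"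
  using assms unfolding union_pa_def Let_def pa.simps mem_Collect_eq
  by (elim exE conjE) (rule that; simp)

lemma is_pa_union_pa:
  assumes J: "finite J" and A: "\<And>i. i \<in> J \<Longrightarrow> is_pa \<Sigma> (A i)"
  shows "is_pa \<Sigma> (union_pa J A)"
proof -
  define D where "D = (\<Sum>i\<in>J. dim (A i))"
  have D: "dim (A i) \<le> D" if "i \<in> J" for i
    unfolding D_def using J that by (intro member_le_sum) auto
  let ?f = "\<lambda>((i, p, x, v, q), c). (to_nat (if c then None else Some (i, p)), x,
      pad D (if c then i else 0) v, to_nat (Some (i, q)))"
  have "trans (union_pa J A) \<subseteq> ?f ` (Sigma J (\<lambda>i. trans (A i)) \<times> (UNIV :: bool set))"
  proof
    fix e assume "e \<in> trans (union_pa J A)"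
    then obtain c i p x v q where "i \<in> J" "(p, x, v, q) \<in> trans (A i)"
      "e = (to_nat (if c then None else Some (i, p)), x, pad D (if c then i else 0) v,
        to_nat (Some (i, q)))"
      unfolding D_def by (rule union_pa_transE)
    then show "e \<in> ?f ` (Sigma J (\<lambda>i. trans (A i)) \<times> (UNIV :: bool set))"
      by (intro image_eqI[of _ _ "((i, p, x, v, q), c)"]) simp_all
  qed
  moreover have "finite (Sigma J (\<lambda>i. trans (A i)) \<times> (UNIV :: bool set))"
    using J A by (auto simp: is_pa_def)
  ultimately have "finite (trans (union_pa J A))"
    using finite_surj by blast
  moreover have "trans (union_pa J A) \<subseteq> {(p, x, v, q). p \<in> states (union_pa J A) \<and> x \<in> \<Sigma> \<and>
      length v = dim (union_pa J A) \<and> q \<in> states (union_pa J A)}"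
  proof
    fix e assume "e \<in> trans (union_pa J A)"
    then obtain c i p x v q where i: "i \<in> J" and tr: "(p, x, v, q) \<in> trans (A i)"
      and e: "e = (to_nat (if c then None else Some (i, p)), x, pad D (if c then i else 0) v,
        to_nat (Some (i, q)))"
      unfolding D_def by (rule union_pa_transE)
    show "e \<in> {(p, x, v, q). p \<in> states (union_pa J A) \<and> x \<in> \<Sigma> \<and>
      length v = dim (union_pa J A) \<and> q \<in> states (union_pa J A)}"
      using is_pa_transD[OF A[OF i] tr] D[OF i] i unfolding e
      by (auto simp: union_pa_def Let_def D_def)
  qed
  moreover have "semilinear (Suc D) (\<Union>i\<in>J. pad D i ` constr (A i))"
    using J A D by (intro semilinear_UN semilinear_pad) (auto simp: is_pa_def)
  moreover have "final (union_pa J A) \<subseteq> states (union_pa J A)"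
    using A unfolding union_pa_def Let_def pa.simps is_pa_def by blast
  ultimately show ?thesis
    using J A unfolding is_pa_def by (simp add: union_pa_def Let_def D_def)
qed

lemma rpba_lang_union_pa:
  assumes J: "finite J" and A: "\<And>i. i \<in> J \<Longrightarrow> is_pa \<Sigma> (A i)"
  shows "rpba_lang (union_pa J A) = (\<Union>i\<in>J. rpba_lang (A i))"
proof (intro equalityI subsetI)
  define D where "D = (\<Sum>i\<in>J. dim (A i))"
  let ?B = "union_pa J A"
  have B: "is_pa \<Sigma> ?B" by (rule is_pa_union_pa[OF J A])
  fix \<alpha> assume "\<alpha> \<in> (\<Union>i\<in>J. rpba_lang (A i))"
  then obtain i s v m where i: "i \<in> J" and path: "inf_path (A i) \<alpha> s v"
    and m: "s (Suc m) \<in> final (A i)" "psum (dim (A i)) v (Suc m) \<in> constr (A i)"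
    and inf: "\<exists>\<^sub>\<infinity>k. s k \<in> final (A i)"
    using rpba_lang_iff[OF A] by blast
  have D: "dim (A i) \<le> D"
    unfolding D_def using J i by (intro member_le_sum) auto
  define S where "S k = to_nat (if k = 0 then None else Some (i, s k))" for k
  define V where "V k = pad D (if k = 0 then i else 0) (v k)" for k :: nat
  have "(S k, \<alpha> k, V k, S (Suc k)) \<in> trans ?B" for k
    unfolding union_pa_def Let_def pa.simps mem_Collect_eq D_def[symmetric]
  proof (intro exI conjI)
    show "(s k, \<alpha> k, v k, s (Suc k)) \<in> trans (A i)" using inf_pathD[OF path] .
    show "(S k, \<alpha> k, V k, S (Suc k)) = (to_nat (if k = 0 then None else Some (i, s k)), \<alpha> k,
        pad D (if k = 0 then i else 0) (v k), to_nat (Some (i, s (Suc k))))"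
      by (simp add: S_def V_def)
    show "k = 0 \<longrightarrow> s k = init (A i)"
      using path by (simp add: inf_path_def)
  qed (rule i)
  then have "inf_path ?B \<alpha> S V"
    by (simp add: inf_path_def S_def union_pa_def Let_def)
  moreover have final: "S (Suc k) \<in> final ?B" if "s (Suc k) \<in> final (A i)" for k
    using that i by (auto simp: S_def union_pa_def Let_def)
  moreover have "psum (dim ?B) V (Suc m) \<in> constr ?B"
  proof -
    have "psum (Suc D) V (Suc m) = pad D i (psum (dim (A i)) v (Suc m))"
      unfolding V_def
      by (rule psum_pad) (use D is_pa_transD[OF A[OF i] inf_pathD[OF path]] in auto)
    then show ?thesis using m(2) i by (auto simp: union_pa_def Let_def D_def)
  qed
  moreover have "\<exists>\<^sub>\<infinity>k. S k \<in> final ?B"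
  proof -
    have "\<exists>\<^sub>\<infinity>k. s (Suc k) \<in> final (A i)"
      using inf INFM_Suc_iff[of "\<lambda>k. s k \<in> final (A i)"] by simp
    then have "\<exists>\<^sub>\<infinity>k. S (Suc k) \<in> final ?B"
      using final by (elim INFM_mono)
    then show ?thesis
      using INFM_Suc_iff[of "\<lambda>k. S k \<in> final ?B"] by simp
  qed
  ultimately show "\<alpha> \<in> rpba_lang ?B"
    using m(1) rpba_lang_iff[OF B] by blast
next
  define D where "D = (\<Sum>i\<in>J. dim (A i))"
  let ?B = "union_pa J A"
  have B: "is_pa \<Sigma> ?B" by (rule is_pa_union_pa[OF J A])
  fix \<alpha> assume "\<alpha> \<in> rpba_lang ?B"
  then obtain S V m where path: "inf_path ?B \<alpha> S V"
    and m: "S (Suc m) \<in> final ?B" "psum (dim ?B) V (Suc m) \<in> constr ?B"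
    and inf: "\<exists>\<^sub>\<infinity>k. S k \<in> final ?B"
    unfolding rpba_lang_iff[OF B] by blast
  have "\<exists>c i p v q. i \<in> J \<and> (p, \<alpha> k, v, q) \<in> trans (A i) \<and> (c \<longrightarrow> p = init (A i)) \<and>
      S k = to_nat (if c then None else Some (i, p)) \<and> V k = pad D (if c then i else 0) v \<and>
      S (Suc k) = to_nat (Some (i, q))" for k
    using inf_pathD[OF path, of k]
  proof (rule union_pa_transE)
    fix c i p x v q
    assume "i \<in> J" "(p, x, v, q) \<in> trans (A i)" "c \<Longrightarrow> p = init (A i)"
      "(S k, \<alpha> k, V k, S (Suc k)) = (to_nat (if c then None else Some (i, p)), x,
        pad (\<Sum>i\<in>J. dim (A i)) (if c then i else 0) v, to_nat (Some (i, q)))"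
    then show ?thesis
      unfolding D_def
      by (intro exI[of _ c] exI[of _ i] exI[of _ p] exI[of _ v] exI[of _ q]) simp
  qed
  then obtain c ix p v q where i: "\<And>k. ix k \<in> J"
    and tr: "\<And>k. (p k, \<alpha> k, v k, q k) \<in> trans (A (ix k))"
    and c: "\<And>k. c k \<Longrightarrow> p k = init (A (ix k))"
    and S: "\<And>k. S k = to_nat (if c k then None else Some (ix k, p k))"
    and V: "\<And>k. V k = pad D (if c k then ix k else 0) (v k)"
    and S': "\<And>k. S (Suc k) = to_nat (Some (ix k, q k))"
    by metis
  have "S 0 = to_nat (None :: (nat \<times> nat) option)"
    using path by (simp add: inf_path_def union_pa_def Let_def)
  then have c0: "c 0" using S[of 0] by (auto split: if_splits)
  \<comment> \<open>Each target names its component and differs from \<open>None\<close>, so the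
    next transition has \<open>c\<close> False and stays in the same component.\<close>
  have Suc: "\<not> c (Suc k)" "ix (Suc k) = ix k" "p (Suc k) = q k" for k
    using S[of "Suc k"] S'[of k] by (auto split: if_splits)
  define i where "i = ix 0"
  have ix: "ix k = i" for k by (induction k) (simp_all add: i_def Suc)
  have ck: "c k \<longleftrightarrow> k = 0" for k using c0 Suc(1) by (cases k) auto
  have iJ: "i \<in> J" using i ix by metis
  have D: "dim (A i) \<le> D"
    unfolding D_def using J iJ by (intro member_le_sum) auto
  have tr': "(p k, \<alpha> k, v k, p (Suc k)) \<in> trans (A i)" for k
    using tr[of k] by (simp add: ix Suc)
  then have path': "inf_path (A i) \<alpha> p v"
    using c[OF c0] by (simp add: inf_path_def ix)
  have final: "p (Suc k) \<in> final (A i)" if "S (Suc k) \<in> final ?B" for k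
    using that S'[of k] by (auto simp: union_pa_def Let_def ix Suc)
  have "psum (dim (A i)) v (Suc m) \<in> constr (A i)"
  proof -
    have V': "V = (\<lambda>k. pad D (if k = 0 then i else 0) (v k))"
      by (rule ext) (simp add: V ck ix)
    have "psum (Suc D) V (Suc m) = pad D i (psum (dim (A i)) v (Suc m))"
      unfolding V'
      by (rule psum_pad) (use D is_pa_transD[OF A[OF iJ] tr'] in auto)
    then obtain i' y where y: "i' \<in> J" "y \<in> constr (A i')"
      "pad D i' y = pad D i (psum (dim (A i)) v (Suc m))"
      using m(2) by (auto simp: union_pa_def Let_def D_def)
    \<comment> \<open>Both vectors begin with their tag, which identifies the component whose
      constraint was met.\<close>
    then have "i' = i" by (simp add: pad_def)
    moreover from this have "length y = dim (A i)"
      using y semilinear_length A[OF iJ] by (auto simp: is_pa_def)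
    ultimately show ?thesis using y pad_inject[of y "psum (dim (A i)) v (Suc m)"] by simp
  qed
  moreover have "\<exists>\<^sub>\<infinity>k. p k \<in> final (A i)"
  proof -
    have "\<exists>\<^sub>\<infinity>k. S (Suc k) \<in> final ?B"
      using inf INFM_Suc_iff[of "\<lambda>k. S k \<in> final ?B"] by simp
    then have "\<exists>\<^sub>\<infinity>k. p (Suc k) \<in> final (A i)"
      using final by (elim INFM_mono)
    then show ?thesis
      using INFM_Suc_iff[of "\<lambda>k. p k \<in> final (A i)"] by simp
  qed
  ultimately have "\<alpha> \<in> rpba_lang (A i)"
    unfolding rpba_lang_iff[OF A[OF iJ]] using path' final[OF m(1)] by blast
  then show "\<alpha> \<in> (\<Union>i\<in>J. rpba_lang (A i))"
    using iJ by blast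
qed

section \<open>Concatenation of a Parikh-recognizable language with a regular omega-power\<close>

text \<open>States \<open>Inl p\<close> simulate the Parikh automaton and \<open>Inr (Some p)\<close> the finite automaton
  inside a block. Block boundaries are marked by the only final state \<open>Inr None\<close>, except that the
  first block starts in an accepting state of the Parikh automaton.\<close>

definition block_srcs :: "('a, nat) pa \<Rightarrow> 'a nfa \<Rightarrow> nat \<Rightarrow> (nat + nat option) set" where
  "block_srcs A N p = insert (Inr (Some p))
     (if p = ninit N then insert (Inr None) (Inl ` final A) else {})"

definition block_tgts :: "'a nfa \<Rightarrow> nat \<Rightarrow> (nat + nat option) set" where
  "block_tgts N q = insert (Inr (Some q)) (if q \<in> nfinal N then {Inr None} else {})"

definition conc_pa :: "('a, nat) pa \<Rightarrow> 'a nfa \<Rightarrow> ('a, nat) pa" where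
  "conc_pa A N = \<lparr>states = to_nat ` (Inl ` states A \<union> Inr ` insert None (Some ` nstates N)),
     dim = dim A, init = to_nat (Inl (init A) :: nat + nat option),
     trans = (\<lambda>(p, x, v, q). (to_nat (Inl p :: nat + nat option), x, v,
          to_nat (Inl q :: nat + nat option))) ` trans A \<union>
       {(to_nat a, x, replicate (dim A) 0, to_nat b) | a b p x q.
          (p, x, q) \<in> ndelta N \<and> a \<in> block_srcs A N p \<and> b \<in> block_tgts N q},
     final = {to_nat (Inr None :: nat + nat option)}, constr = constr A\<rparr>"

lemma is_pa_conc_pa:
  assumes "finite \<Sigma>" and A: "is_pa \<Sigma> A" and N: "is_nfa \<Sigma> N"
  shows "is_pa \<Sigma> (conc_pa A N)"
proof -
  let ?Z = "Inl ` states A \<union> Inr ` insert None (Some ` nstates N) :: (nat + nat option) set"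
  let ?T = "{(to_nat a, x, replicate (dim A) 0, to_nat b) | a b p x q.
          (p, x, q) \<in> ndelta N \<and> a \<in> block_srcs A N p \<and> b \<in> block_tgts N q}"
  have fin: "finite ?Z"
    using A N by (simp add: is_pa_def is_nfa_def)
  have "final A \<subseteq> states A" using A by (simp add: is_pa_def)
  then have "a \<in> ?Z \<and> x \<in> \<Sigma> \<and> b \<in> ?Z"
    if "(p, x, q) \<in> ndelta N" "a \<in> block_srcs A N p" "b \<in> block_tgts N q" for a b p x q
    using that N by (auto simp: is_nfa_def block_srcs_def block_tgts_def split: if_splits)
  \<comment> \<open>\<open>is_nfa\<close> bounds \<open>ndelta\<close> without stating that it is
    finite; finiteness comes from this product of finitely many states and the finite
    alphabet.\<close>
  then have T: "?T \<subseteq> to_nat ` ?Z \<times> \<Sigma> \<times> {replicate (dim A) 0} \<times> to_nat ` ?Z"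
    by blast
  then have "finite ?T"
    by (rule finite_subset) (use fin assms(1) in blast)
  then have "finite (trans (conc_pa A N))"
    using A by (simp add: conc_pa_def is_pa_def)
  moreover have "trans (conc_pa A N) \<subseteq> {(p, x, v, q). p \<in> states (conc_pa A N) \<and> x \<in> \<Sigma> \<and>
      length v = dim (conc_pa A N) \<and> q \<in> states (conc_pa A N)}"
  proof -
    have "?T \<subseteq> {(p, x, v, q). p \<in> to_nat ` ?Z \<and> x \<in> \<Sigma> \<and> length v = dim A \<and> q \<in> to_nat ` ?Z}"
      by (rule order.trans[OF T]) auto
    then show ?thesis
      unfolding conc_pa_def pa.simps
      by (intro Un_least) (auto dest: is_pa_transD[OF A])
  qed
  moreover have "finite (states (conc_pa A N))"
    unfolding conc_pa_def pa.simps using fin by (rule finite_imageI)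
  moreover have "init (conc_pa A N) \<in> states (conc_pa A N)"
    using A by (auto simp: conc_pa_def is_pa_def)
  moreover have "final (conc_pa A N) \<subseteq> states (conc_pa A N)"
    by (auto simp: conc_pa_def)
  moreover have "semilinear (dim (conc_pa A N)) (constr (conc_pa A N))"
    using A by (simp add: conc_pa_def is_pa_def)
  ultimately show ?thesis
    unfolding is_pa_def by blast
qed

lemma conc_subset_rpba_lang:
  assumes "finite \<Sigma>" and A: "is_pa \<Sigma> A" and N: "is_nfa \<Sigma> N"
    and "\<alpha> \<in> conc_omega (pa_lang A) (omega_pow (nfa_lang N))"
  shows "\<alpha> \<in> rpba_lang (conc_pa A N)"
proof -
  let ?d = "dim A" let ?B = "conc_pa A N"
  obtain g where g: "strict_mono g" and pre: "map \<alpha> [0..<g 0] \<in> pa_lang A"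
    and blocks: "\<And>i. map \<alpha> [g i..<g (Suc i)] \<in> nfa_lang N"
    using assms(4) unfolding conc_omega_pow_iff by blast
  have lt: "g i < g (Suc i)" for i using g by (simp add: strict_mono_less)
  obtain s v where s: "s 0 = init A" "s (g 0) \<in> final A" "psum ?d v (g 0) \<in> constr A"
    and str: "\<And>k. k < g 0 \<Longrightarrow> (s k, \<alpha> k, v k, s (Suc k)) \<in> trans A"
    using pre unfolding prefix_in_pa_lang_iff[OF A] by blast
  have "\<forall>i. \<exists>t. t (g i) = ninit N \<and>
    (\<forall>k. g i \<le> k \<and> k < g (Suc i) \<longrightarrow> (t k, \<alpha> k, t (Suc k)) \<in> ndelta N) \<and> t (g (Suc i)) \<in> nfinal N"
    using blocks factor_in_nfa_lang_iff[OF less_imp_le[OF lt]] by blast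
  then obtain t where t: "\<And>i. t i (g i) = ninit N" "\<And>i. t i (g (Suc i)) \<in> nfinal N"
    "\<And>i k. g i \<le> k \<Longrightarrow> k < g (Suc i) \<Longrightarrow> (t i k, \<alpha> k, t i (Suc k)) \<in> ndelta N"
    by metis
  \<comment> \<open>The first cut is an accepting state of the Parikh part, from which the first
    block departs; every later cut is the boundary state \<open>Inr None\<close>.\<close>
  define t' :: "nat \<Rightarrow> nat \<Rightarrow> nat + nat option" where
    "t' i k = (if k = g i then (if i = 0 then Inl (s k) else Inr None)
      else if k = g (Suc i) then Inr None else Inr (Some (t i k)))" for i k
  define S where "S = glue g (\<lambda>k. Inl (s k)) t'"
  define V where "V k = (if k < g 0 then v k else replicate ?d 0)" for k
  have closed: "t' i (g (Suc i)) = t' (Suc i) (g (Suc i))" for i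
    using lt[of i] by (simp add: t'_def)
  have S_blk: "S k = t' i k" if "g i \<le> k" "k \<le> g (Suc i)" for i k
    unfolding S_def by (rule glue_closed[OF g that closed])
  have S_pre: "S k = Inl (s k)" if "k \<le> g 0" for k
  proof (cases "k = g 0")
    case True
    then show ?thesis using S_blk[of 0 k] lt[of 0] by (simp add: t'_def)
  qed (use that in \<open>simp add: S_def glue_prefix\<close>)
  have bnd: "S (g (Suc i)) = Inr None" for i
    using S_blk[of i "g (Suc i)"] lt[of i] by (simp add: t'_def)
  have "(to_nat (S k), \<alpha> k, V k, to_nat (S (Suc k))) \<in> trans ?B" for k
  proof (rule block_cases[OF g, of k])
    assume "k < g 0"
    then show ?thesis
      using str[of k] by (force simp: S_pre V_def conc_pa_def)
  next
    fix i assume k: "g i \<le> k" "k < g (Suc i)"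
    then have "V k = replicate ?d 0"
      using g strict_mono_less_eq[OF g, of 0 i] by (simp add: V_def)
    moreover have "S k \<in> block_srcs A N (t i k)"
      using k s(2) t(1)[of i] by (auto simp: S_blk[of i] t'_def block_srcs_def)
    moreover have "S (Suc k) \<in> block_tgts N (t i (Suc k))"
      using k t(2)[of i] by (auto simp: S_blk[of i] t'_def block_tgts_def)
    ultimately show ?thesis
      using t(3)[OF k] unfolding conc_pa_def pa.simps by blast
  qed
  then have "inf_path ?B \<alpha> (\<lambda>k. to_nat (S k)) V"
    using s(1) S_pre[of 0] by (simp add: inf_path_def conc_pa_def)
  \<comment> \<open>The constraint is tested at the end of the first block, a successor position
    even when the prefix is empty.\<close>
  moreover obtain m where m: "g (Suc 0) = Suc m" using lt[of 0] by (cases "g (Suc 0)") auto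
  moreover have "psum (dim ?B) V (Suc m) \<in> constr ?B"
  proof -
    have "psum ?d V (Suc m) = psum ?d V (g 0)"
      using lt[of 0] m by (intro psum_eq_of_zero_tail) (auto simp: V_def)
    also have "\<dots> = psum ?d v (g 0)" by (rule psum_cong) (simp add: V_def)
    finally show ?thesis using s(3) by (simp add: conc_pa_def)
  qed
  moreover have "to_nat (S (Suc m)) \<in> final ?B"
    using bnd[of 0] m by (simp add: conc_pa_def)
  moreover have "\<exists>\<^sub>\<infinity>k. to_nat (S k) \<in> final ?B"
    unfolding INFM_nat
  proof
    fix n
    have "n < g (Suc n)" using strict_mono_imp_increasing[OF g, of "Suc n"] by simp
    then show "\<exists>k>n. to_nat (S k) \<in> final ?B"
      using bnd[of n] by (intro exI[of _ "g (Suc n)"]) (simp add: conc_pa_def)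
  qed
  ultimately show ?thesis
    unfolding rpba_lang_iff[OF is_pa_conc_pa[OF assms(1) A N]] by blast
qed

text \<open>A run that has left the Parikh part cannot return to it. The transition at the last
  position \<open>m\<close> in that part therefore splits the run: it departs from a final state of
  \<open>A\<close> and reads the first letter of a block. The visits of \<open>Inr None\<close> cut
  the rest into blocks.\<close>

lemma rpba_lang_subset_conc:
  assumes "finite \<Sigma>" and A: "is_pa \<Sigma> A" and N: "is_nfa \<Sigma> N"
    and "\<alpha> \<in> rpba_lang (conc_pa A N)"
  shows "\<alpha> \<in> conc_omega (pa_lang A) (omega_pow (nfa_lang N))"
proof -
  let ?d = "dim A" let ?B = "conc_pa A N"
  obtain S' V i where path: "inf_path ?B \<alpha> S' V"
    and acc: "S' (Suc i) \<in> final ?B" "psum ?d V (Suc i) \<in> constr A"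
    and inf: "\<exists>\<^sub>\<infinity>k. S' k \<in> final ?B"
    using assms(4) unfolding rpba_lang_iff[OF is_pa_conc_pa[OF assms(1) A N]]
    by (auto simp: conc_pa_def)
  define S where "S k = (from_nat (S' k) :: nat + nat option)" for k
  have S0: "S 0 = Inl (init A)"
    using path by (simp add: S_def inf_path_def conc_pa_def)
  have final: "S k = Inr None" if "S' k \<in> final ?B" for k
    using that by (simp add: S_def conc_pa_def)
  have step: "(\<exists>p q. S k = Inl p \<and> S (Suc k) = Inl q \<and> (p, \<alpha> k, V k, q) \<in> trans A) \<or>
      (V k = replicate ?d 0 \<and> (\<exists>p q. (p, \<alpha> k, q) \<in> ndelta N \<and>
        S k \<in> block_srcs A N p \<and> S (Suc k) \<in> block_tgts N q))" for k
    using inf_pathD[OF path, of k] by (auto simp: conc_pa_def S_def)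
  have isl_back: "isl (S k)" if "isl (S (Suc k))" for k
    using step[of k] that by (auto simp: block_tgts_def split: if_splits)
  define m where "m = (LEAST k. \<not> isl (S (Suc k)))"
  have "\<not> isl (S (Suc i))" using final[OF acc(1)] by simp
  then have m: "\<not> isl (S (Suc m))" and "m \<le> i"
    unfolding m_def by (rule LeastI, rule Least_le)
  have pre: "isl (S k)" if "k \<le> m" for k
  proof (cases k)
    case (Suc l)
    then have "l < (LEAST k. \<not> isl (S (Suc k)))" using that by (simp add: m_def)
    from not_less_Least[OF this] show ?thesis by (simp add: Suc)
  qed (simp add: S0)
  have post: "\<not> isl (S k)" if "m < k" for k
    using that
  proof (induction k)
    case (Suc k)
    then show ?case using m isl_back by (metis less_antisym)
  qed simp
  have tail: "V k = replicate ?d 0 \<and> (\<exists>p q. (p, \<alpha> k, q) \<in> ndelta N \<and>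
      S k \<in> block_srcs A N p \<and> S (Suc k) \<in> block_tgts N q)" if "m \<le> k" for k
    using step[of k] post[of "Suc k"] that by auto
  define s where "s k = projl (S k)" for k
  have head: "(s k, \<alpha> k, V k, s (Suc k)) \<in> trans A" if "k < m" for k
    using step[of k] pre[of "Suc k"] that
    by (auto simp: s_def block_tgts_def split: if_splits)
  have sm: "s m \<in> final A"
    using tail[of m] pre[of m] by (auto simp: s_def block_srcs_def split: if_splits)
  define X where "X = {k. S k = Inr None}"
  have X: "infinite X"
    using inf final unfolding X_def INFM_iff_infinite by (metis (mono_tags, lifting) Collect_mono finite_subset)
  have Xm: "m < k" if "k \<in> X" for k
    using that pre[of k] by (cases "k \<le> m") (auto simp: X_def)
  define g where "g i = (case i of 0 \<Rightarrow> m | Suc n \<Rightarrow> enumerate X n)" for i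
  have g_in: "g (Suc n) \<in> X" for n using enumerate_in_set[OF X] by (simp add: g_def)
  have lt: "g n < g (Suc n)" for n
    using Xm[OF g_in[of 0]] enumerate_step[OF X] by (cases n) (auto simp: g_def)
  then have g: "strict_mono g" by (simp add: strict_mono_Suc_iff)
  \<comment> \<open>The enumeration hits every visit of \<open>Inr None\<close>, so no boundary lies
    strictly inside a block.\<close>
  have gap: "k \<notin> X" if "g n < k" "k < g (Suc n)" for n k
  proof
    assume "k \<in> X"
    then obtain j where "k = g (Suc j)" using enumerate_Ex[OF X] by (auto simp: g_def)
    then show False using that strict_mono_less[OF g] by simp
  qed
  \<comment> \<open>\<open>P\<close> and \<open>Q\<close> are the states of \<open>N\<close> before
    and after a letter. The boundary state hides them, so they are read off the transitions.\<close>
  obtain P Q where PQ: "\<And>k. m \<le> k \<Longrightarrow> (P k, \<alpha> k, Q k) \<in> ndelta N \<and>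
      S k \<in> block_srcs A N (P k) \<and> S (Suc k) \<in> block_tgts N (Q k)"
    using tail by metis
  have m_le: "m \<le> g n" for n
    using strict_mono_less_eq[OF g, of 0 n] by (simp add: g_def)
  have "map \<alpha> [g n..<g (Suc n)] \<in> nfa_lang N" for n
    unfolding factor_in_nfa_lang_iff[OF less_imp_le[OF lt]]
  proof (intro exI[of _ "\<lambda>k. if k = g n then ninit N else Q (k - 1)"] conjI allI impI)
    let ?t = "\<lambda>k. if k = g n then ninit N else Q (k - 1)"
    show "?t (g n) = ninit N" by simp
    obtain b where b: "g (Suc n) = Suc b" using lt[of n] by (cases "g (Suc n)") auto
    have "S (Suc b) = Inr None" using g_in[of n] b by (simp add: X_def)
    moreover have "m \<le> b" using m_le[of n] lt[of n] b by simp
    ultimately have "Q b \<in> nfinal N"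
      using PQ[of b] by (auto simp: block_tgts_def split: if_splits)
    then show "?t (g (Suc n)) \<in> nfinal N" using lt[of n] b by simp
    fix k assume k: "g n \<le> k \<and> k < g (Suc n)"
    then have mk: "m \<le> k" using m_le[of n] by simp
    \<comment> \<open>At a cut the only possible source is \<open>ninit N\<close>. Inside a block
      \<open>S k\<close> has the form \<open>Inr (Some p)\<close>, which names both the target of
      one letter and the source of the next.\<close>
    have "P k = ?t k"
    proof (cases "k = g n")
      case True
      have "S k = Inr None \<or> isl (S k)"
        using True g_in pre[of m] by (cases n) (auto simp: g_def X_def)
      then show ?thesis
        using True PQ[OF mk] by (auto simp: block_srcs_def split: if_splits)
    next
      case False
      then obtain l where l: "k = Suc l" "m \<le> l" using k m_le[of n] by (cases k) auto
      have "k \<notin> X" using gap[of n k] k False by simp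
      moreover have "\<not> isl (S k)" using post[of k] l by simp
      ultimately show ?thesis
        using PQ[OF mk] PQ[OF l(2)] l(1) False
        by (auto simp: X_def block_srcs_def block_tgts_def split: if_splits)
    qed
    then show "(?t k, \<alpha> k, ?t (Suc k)) \<in> ndelta N" using PQ[OF mk] k by auto
  qed
  moreover have "map \<alpha> [0..<g 0] \<in> pa_lang A"
  proof -
    \<comment> \<open>From \<open>m\<close> on all vectors are zero, so the sum tested at
      \<open>Suc i\<close> is already attained at \<open>m\<close>.\<close>
    have "psum ?d V (Suc i) = psum ?d V m"
      using tail \<open>m \<le> i\<close> by (intro psum_eq_of_zero_tail) auto
    then show ?thesis
      unfolding prefix_in_pa_lang_iff[OF A]
      using S0 head sm acc(2) by (intro exI[of _ s] exI[of _ V]) (simp add: g_def s_def)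
  qed
  ultimately show ?thesis
    using g unfolding conc_omega_pow_iff by blast
qed

lemma rpba_lang_conc_pa:
  "finite \<Sigma> \<Longrightarrow> is_pa \<Sigma> A \<Longrightarrow> is_nfa \<Sigma> N \<Longrightarrow>
    rpba_lang (conc_pa A N) = conc_omega (pa_lang A) (omega_pow (nfa_lang N))"
  using conc_subset_rpba_lang rpba_lang_subset_conc by blast

section \<open>Assembling the equivalence\<close>

lemma rpba_recognizable_UN_conc:
  fixes J :: "nat set"
  assumes "finite \<Sigma>" and J: "finite J"
    and UV: "\<And>i. i \<in> J \<Longrightarrow> parikh_recognizable \<Sigma> (U i) \<and> regular \<Sigma> (V i)"
  shows "rpba_recognizable \<Sigma> (\<Union>i\<in>J. conc_omega (U i) (omega_pow (V i)))"
proof -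
  have "\<forall>i\<in>J. \<exists>A N. is_pa \<Sigma> A \<and> pa_lang A = U i \<and> is_nfa \<Sigma> N \<and> nfa_lang N = V i"
    using UV unfolding parikh_recognizable_def regular_def by blast
  then obtain A N where AN: "\<And>i. i \<in> J \<Longrightarrow> is_pa \<Sigma> (A i) \<and> pa_lang (A i) = U i \<and>
      is_nfa \<Sigma> (N i) \<and> nfa_lang (N i) = V i"
    by metis
  let ?B = "\<lambda>i. conc_pa (A i) (N i)"
  have B: "is_pa \<Sigma> (?B i)" if "i \<in> J" for i
    using is_pa_conc_pa[OF assms(1)] AN that by blast
  have "rpba_lang (union_pa J ?B) = (\<Union>i\<in>J. rpba_lang (?B i))"
    by (rule rpba_lang_union_pa[OF J B])
  moreover have "\<dots> = (\<Union>i\<in>J. conc_omega (U i) (omega_pow (V i)))"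
    using AN rpba_lang_conc_pa[OF assms(1)] by (intro SUP_cong) auto
  moreover have "is_pa \<Sigma> (union_pa J ?B)"
    by (rule is_pa_union_pa[OF J B])
  ultimately show ?thesis
    unfolding rpba_recognizable_def by metis
qed

lemma lpba_recognizable_imp_UN_conc:
  assumes "lpba_recognizable \<Sigma> L"
  shows "\<exists>n::nat. \<exists>U V. (\<forall>i \<in> {1..n}. U i \<subseteq> lists \<Sigma> \<and> parikh_recognizable \<Sigma> (U i) \<and>
      V i \<subseteq> lists \<Sigma> \<and> regular \<Sigma> (V i)) \<and>
    L = (\<Union>i \<in> {1..n}. conc_omega (U i) (omega_pow (V i)))"
proof -
  obtain A :: "('a, enat) pa" where A: "is_pa \<Sigma> A" "lpba_lang A = L"
    using assms unfolding lpba_recognizable_def by blast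
  let ?X = "final A \<times> Pow {..<dim A}"
  have "finite ?X" using A(1) finite_subset by (auto simp: is_pa_def)
  \<comment> \<open>Numbering the pairs from 1 fits the index range \<open>{1..n}\<close>. Without
    final states there are no pairs, and both the union and \<open>L\<close> are empty.\<close>
  then obtain h where h: "bij_betw h {1..card ?X} ?X"
    using ex_bij_betw_nat_finite_1 by blast
  define U where "U i = pa_lang (prefix_pa A (fst (h i)) (snd (h i)))" for i
  define V where "V i = nfa_lang (loop_nfa A (fst (h i)) (snd (h i)))" for i
  have "U i \<subseteq> lists \<Sigma> \<and> parikh_recognizable \<Sigma> (U i) \<and> V i \<subseteq> lists \<Sigma> \<and> regular \<Sigma> (V i)"
    if "i \<in> {1..card ?X}" for i
  proof -
    have "fst (h i) \<in> final A" using bij_betwE[OF h] that by (metis mem_Times_iff)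
    then have "is_pa \<Sigma> (prefix_pa A (fst (h i)) (snd (h i)))"
      "is_nfa \<Sigma> (loop_nfa A (fst (h i)) (snd (h i)))"
      using is_pa_prefix_pa[OF A(1)] is_nfa_loop_nfa[OF A(1)] by blast+
    then show ?thesis
      using pa_lang_subset_lists nfa_lang_subset_lists
      unfolding U_def V_def parikh_recognizable_def regular_def by blast
  qed
  moreover have "L = (\<Union>i \<in> {1..card ?X}. conc_omega (U i) (omega_pow (V i)))"
  proof -
    have "L = (\<Union>(f, I) \<in> ?X.
        conc_omega (pa_lang (prefix_pa A f I)) (omega_pow (nfa_lang (loop_nfa A f I))))"
    proof (intro equalityI subsetI)
      fix \<alpha> assume "\<alpha> \<in> L"
      then obtain f I where "f \<in> final A" "I \<subseteq> {..<dim A}"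
        "\<alpha> \<in> conc_omega (pa_lang (prefix_pa A f I)) (omega_pow (nfa_lang (loop_nfa A f I)))"
        using lpba_lang_subset_UN[OF A(1)] A(2) by blast
      then show "\<alpha> \<in> (\<Union>(f, I) \<in> ?X.
          conc_omega (pa_lang (prefix_pa A f I)) (omega_pow (nfa_lang (loop_nfa A f I))))"
        by (intro UN_I[of "(f, I)"]) simp_all
    next
      fix \<alpha> assume "\<alpha> \<in> (\<Union>(f, I) \<in> ?X.
          conc_omega (pa_lang (prefix_pa A f I)) (omega_pow (nfa_lang (loop_nfa A f I))))"
      then obtain f I where "f \<in> final A" "I \<subseteq> {..<dim A}"
        "\<alpha> \<in> conc_omega (pa_lang (prefix_pa A f I)) (omega_pow (nfa_lang (loop_nfa A f I)))"
        by auto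
      then show "\<alpha> \<in> L" using UN_subset_lpba_lang[OF A(1)] A(2) by blast
    qed
    also have "\<dots> = (\<Union>(f, I) \<in> h ` {1..card ?X}.
        conc_omega (pa_lang (prefix_pa A f I)) (omega_pow (nfa_lang (loop_nfa A f I))))"
      using bij_betw_imp_surj_on[OF h] by simp
    finally show ?thesis by (simp add: U_def V_def case_prod_unfold)
  qed
  ultimately show ?thesis by blast
qed

theorem theorem2:
  fixes \<Sigma> :: "'a set" and L :: "(nat \<Rightarrow> 'a) set"
  assumes "finite \<Sigma>" and "\<Sigma> \<noteq> {}"
    and "L \<subseteq> {\<alpha>. \<forall>n. \<alpha> n \<in> \<Sigma>}"
  shows "((\<exists>n::nat. \<exists>U V :: nat \<Rightarrow> 'a list set.
             (\<forall>i \<in> {1..n}. U i \<subseteq> lists \<Sigma> \<and> parikh_recognizable \<Sigma> (U i) \<and>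
                           V i \<subseteq> lists \<Sigma> \<and> regular \<Sigma> (V i)) \<and>
             L = (\<Union>i \<in> {1..n}. conc_omega (U i) (omega_pow (V i))))
          \<longleftrightarrow> lpba_recognizable \<Sigma> L)
       \<and> (lpba_recognizable \<Sigma> L \<longleftrightarrow> rpba_recognizable \<Sigma> L)"
    (is "(?UV \<longleftrightarrow> _) \<and> _")
proof -
  have "?UV \<Longrightarrow> rpba_recognizable \<Sigma> L"
    using rpba_recognizable_UN_conc[OF assms(1) finite_atLeastAtMost] by blast
  moreover have "rpba_recognizable \<Sigma> L \<Longrightarrow> lpba_recognizable \<Sigma> L"
    unfolding rpba_recognizable_def lpba_recognizable_def
    using is_pa_freeze_pa lpba_lang_freeze_pa by blast
  moreover have "lpba_recognizable \<Sigma> L \<Longrightarrow> ?UV"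
    by (rule lpba_recognizable_imp_UN_conc)
  ultimately show ?thesis by blast
qed

end
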